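(* Let $A$ be a (not necessarily unital) C*-algebra, let $Z(M(A))$ be the center of its multiplier algebra $M(A)$, and let $X$ be a full (left) Hilbert $A$-module. Let $T: X \to X$ be a bijective bounded $A$-module morphism such that every $A$-submodule $Y \subseteq X$ (norm-closed or not) is invariant under $T$, i.e. $T(Y) \subseteq Y$. Then there exists an invertible element $d \in Z(M(A))$ such that $T = d \cdot \mathrm{id}_X$, i.e. $T(x) = d x$ for all $x \in X$.
   Context: A (left) Hilbert $A$-module is a complex vector space $X$ which is a left $A$-module with compatible complex-linear structures, equipped with a map $\langle \cdot,\cdot\rangle : X \times X \to A$ that is $A$-linear in the first and conjugate-$A$-linear in the second variable and satisfies $\langle x,y\rangle = \langle y,x\rangle^*$, $\langle x,x\rangle \ge 0$, and $\langle x,x\rangle = 0$ iff $x=0$, and which is complete in the norm $\|x\| = \|\langle x,x\rangle\|_A^{1/2}$. It is full if the norm-closure of the linear hull of $\{\langle x,y\rangle : x,y\in X\}$ equals $A$. An $A$-submodule is a complex-linear subspace $Y$ with $aY \subseteq Y$ for all $a \in A$. A bounded module morphism is a bounded linear map $T$ with $T(ax)=aT(x)$ for all $a\in A$, $x\in X$ (adjointability is not assumed). The $A$-action on $X$ extends canonically to an action of $M(A)$, which is how $d \in Z(M(A))$ acts on $X$. *)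

theory Defs
  imports "HOL-Analysis.Analysis"
begin

text \<open>
  The superclasses provide a complete real normed algebra, in general without unit.  The class
  adds the complex scalar multiplication and the involution.
\<close>

class cstar_algebra = real_normed_algebra + banach +
  fixes scaleC :: "complex \<Rightarrow> 'a \<Rightarrow> 'a"  (infixr "*\<^sub>C" 75)
    and star :: "'a \<Rightarrow> 'a"
  assumes scaleC_add_right: "c *\<^sub>C (a + b) = c *\<^sub>C a + c *\<^sub>C b"
    and scaleC_add_left: "(c + c') *\<^sub>C a = c *\<^sub>C a + c' *\<^sub>C a"
    and scaleC_scaleC: "c *\<^sub>C (c' *\<^sub>C a) = (c * c') *\<^sub>C a"
    and scaleC_of_real: "complex_of_real r *\<^sub>C a = r *\<^sub>R a"
    and mult_scaleC_left: "(c *\<^sub>C a) * b = c *\<^sub>C (a * b)"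
    and mult_scaleC_right: "a * (c *\<^sub>C b) = c *\<^sub>C (a * b)"
    and norm_scaleC: "norm (c *\<^sub>C a) = cmod c * norm a"
    and star_add: "star (a + b) = star a + star b"
    and star_scaleC: "star (c *\<^sub>C a) = cnj c *\<^sub>C star a"
    and star_mult: "star (a * b) = star b * star a"
    and star_star: "star (star a) = a"
    and norm_star_mult_self: "norm (star a * a) = (norm a)\<^sup>2"

lemma vector_space_scaleC: "vector_space (scaleC :: complex \<Rightarrow> 'a::cstar_algebra \<Rightarrow> 'a)"
proof
  show "1 *\<^sub>C a = a" for a :: 'a
    using scaleC_of_real[of 1 a] by simp
qed (simp_all add: scaleC_add_right scaleC_add_left scaleC_scaleC)

interpretation cvec: vector_space "scaleC :: complex \<Rightarrow> 'a::cstar_algebra \<Rightarrow> 'a"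
  by (rule vector_space_scaleC)

text \<open>
  Stating positivity as \<open>a = b\<^sup>* b\<close> avoids the spectrum, which in the absence of a unit would
  have to be taken in the unitization.
\<close>

definition positive :: "'a::cstar_algebra \<Rightarrow> bool" where
  "positive a \<longleftrightarrow> (\<exists>b. a = star b * b)"


section \<open>The multiplier algebra\<close>

definition bounded_clinear :: "('a::cstar_algebra \<Rightarrow> 'a) \<Rightarrow> bool" where
  "bounded_clinear f \<longleftrightarrow> bounded_linear f \<and> (\<forall>c a. f (c *\<^sub>C a) = c *\<^sub>C f a)"

definition double_centralizer :: "('a::cstar_algebra \<Rightarrow> 'a) \<Rightarrow> ('a \<Rightarrow> 'a) \<Rightarrow> bool" where
  "double_centralizer L R \<longleftrightarrow>
     bounded_clinear L \<and> bounded_clinear R \<and>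
     (\<forall>a b. L (a * b) = L a * b) \<and> (\<forall>a b. R (a * b) = a * R b) \<and>
     (\<forall>a b. R a * b = a * L b)"

lemma bounded_clinear_id: "bounded_clinear (\<lambda>a. a)"
  by (simp add: bounded_clinear_def bounded_linear_ident)

lemma bounded_clinear_compose:
  "bounded_clinear f \<Longrightarrow> bounded_clinear g \<Longrightarrow> bounded_clinear (\<lambda>a. f (g a))"
  by (simp add: bounded_clinear_def bounded_linear_compose)

lemma bounded_clinear_zero: "bounded_clinear (\<lambda>a. 0)"
  by (simp add: bounded_clinear_def)

lemma bounded_clinear_add:
  "bounded_clinear f \<Longrightarrow> bounded_clinear g \<Longrightarrow> bounded_clinear (\<lambda>a. f a + g a)"
  by (simp add: bounded_clinear_def bounded_linear_add scaleC_add_right)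

lemma bounded_clinear_minus: "bounded_clinear f \<Longrightarrow> bounded_clinear (\<lambda>a. - f a)"
  by (simp add: bounded_clinear_def bounded_linear_minus)

text \<open>
  \<open>M(A)\<close> is the algebra of double centralizers.  For a multiplier \<open>d\<close>, \<open>lmul d a\<close> is the
  product \<open>da\<close> and \<open>rmul d a\<close> is the product \<open>ad\<close>.
\<close>

typedef (overloaded) 'a multiplier =
  "{(L, R). double_centralizer (L :: 'a::cstar_algebra \<Rightarrow> 'a) R}"
  by (rule exI[of _ "(\<lambda>a. a, \<lambda>a. a)"]) (simp add: double_centralizer_def bounded_clinear_id)

definition lmul :: "'a::cstar_algebra multiplier \<Rightarrow> 'a \<Rightarrow> 'a" where
  "lmul d = fst (Rep_multiplier d)"

definition rmul :: "'a::cstar_algebra multiplier \<Rightarrow> 'a \<Rightarrow> 'a" where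
  "rmul d = snd (Rep_multiplier d)"

lemma double_centralizer_mul: "double_centralizer (lmul d) (rmul d)"
  using Rep_multiplier[of d] by (simp add: lmul_def rmul_def split_beta)

lemma multiplier_eqI: "lmul d = lmul e \<Longrightarrow> rmul d = rmul e \<Longrightarrow> d = e"
  by (metis Rep_multiplier_inject lmul_def rmul_def prod.expand)

lemma mul_Abs:
  assumes "double_centralizer L R"
  shows "lmul (Abs_multiplier (L, R)) = L" "rmul (Abs_multiplier (L, R)) = R"
  using assms by (simp_all add: lmul_def rmul_def Abs_multiplier_inverse)

instantiation multiplier :: (cstar_algebra) "{ring, monoid_mult}"
begin

definition "0 = Abs_multiplier (\<lambda>a. 0, \<lambda>a. 0)"

definition "1 = Abs_multiplier (\<lambda>a. a, \<lambda>a. a)"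

definition "d + e = Abs_multiplier (\<lambda>a. lmul d a + lmul e a, \<lambda>a. rmul d a + rmul e a)"

definition "- d = Abs_multiplier (\<lambda>a. - lmul d a, \<lambda>a. - rmul d a)"

definition "d - e = d + - (e :: 'a multiplier)"

definition "d * e = Abs_multiplier (\<lambda>a. lmul d (lmul e a), \<lambda>a. rmul e (rmul d a))"

lemma mul_zero: "lmul 0 = (\<lambda>a::'a. 0)" "rmul 0 = (\<lambda>a::'a. 0)"
  unfolding zero_multiplier_def
  by (subst mul_Abs; simp add: double_centralizer_def bounded_clinear_zero)+

lemma mul_one: "lmul 1 = (\<lambda>a::'a. a)" "rmul 1 = (\<lambda>a::'a. a)"
  unfolding one_multiplier_def
  by (subst mul_Abs; simp add: double_centralizer_def bounded_clinear_id)+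

lemma mul_plus:
  "lmul (d + e) = (\<lambda>a::'a. lmul d a + lmul e a)" "rmul (d + e) = (\<lambda>a::'a. rmul d a + rmul e a)"
  unfolding plus_multiplier_def using double_centralizer_mul[of d] double_centralizer_mul[of e]
  by (subst mul_Abs; simp add: double_centralizer_def bounded_clinear_add algebra_simps)+

lemma mul_uminus: "lmul (- d) = (\<lambda>a::'a. - lmul d a)" "rmul (- d) = (\<lambda>a::'a. - rmul d a)"
  unfolding uminus_multiplier_def using double_centralizer_mul[of d]
  by (subst mul_Abs; simp add: double_centralizer_def bounded_clinear_minus)+

lemma mul_times:
  "lmul (d * e) = (\<lambda>a::'a. lmul d (lmul e a))" "rmul (d * e) = (\<lambda>a::'a. rmul e (rmul d a))"
  unfolding times_multiplier_def using double_centralizer_mul[of d] double_centralizer_mul[of e]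
  by (subst mul_Abs; simp add: double_centralizer_def bounded_clinear_compose)+

lemma mul_add_right:
  "lmul d (a + b) = lmul d a + lmul d (b::'a)" "rmul d (a + b) = rmul d a + rmul d (b::'a)"
  using double_centralizer_mul[of d]
  by (simp_all add: double_centralizer_def bounded_clinear_def linear_add bounded_linear.linear)

instance
  by standard
    (auto intro!: multiplier_eqI
      simp: mul_zero mul_one mul_plus mul_uminus mul_times mul_add_right
            minus_multiplier_def algebra_simps)

end

definition center :: "'m::times set" where
  "center = {d. \<forall>m. d * m = m * d}"


section \<open>Hilbert modules\<close>

locale pre_hilbert_module = vector_space scale
  for scale :: "complex \<Rightarrow> 'x::ab_group_add \<Rightarrow> 'x" +
  fixes act :: "'a::cstar_algebra \<Rightarrow> 'x \<Rightarrow> 'x"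
    and ip :: "'x \<Rightarrow> 'x \<Rightarrow> 'a"
  assumes act_add_left: "act (a + b) x = act a x + act b x"
    and act_add_right: "act a (x + y) = act a x + act a y"
    and act_mult: "act (a * b) x = act a (act b x)"
    and act_scaleC_left: "act (c *\<^sub>C a) x = scale c (act a x)"
    and act_scale_right: "act a (scale c x) = scale c (act a x)"
    and ip_add_left: "ip (x + y) z = ip x z + ip y z"
    and ip_scale_left: "ip (scale c x) y = c *\<^sub>C ip x y"
    and ip_act_left: "ip (act a x) y = a * ip x y"
    and ip_add_right: "ip x (y + z) = ip x y + ip x z"
    and ip_scale_right: "ip x (scale c y) = cnj c *\<^sub>C ip x y"
    and ip_act_right: "ip x (act a y) = ip x y * star a"
    and ip_star: "ip x y = star (ip y x)"
    and ip_positive: "positive (ip x x)"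
    and ip_eq_0_iff: "ip x x = 0 \<longleftrightarrow> x = 0"
begin

definition hnorm :: "'x \<Rightarrow> real" where
  "hnorm x = sqrt (norm (ip x x))"

end

locale hilbert_module = pre_hilbert_module scale act ip
  for scale :: "complex \<Rightarrow> 'x::ab_group_add \<Rightarrow> 'x"
    and act :: "'a::cstar_algebra \<Rightarrow> 'x \<Rightarrow> 'x"
    and ip :: "'x \<Rightarrow> 'x \<Rightarrow> 'a" +
  assumes complete:
    "(\<forall>e>0. \<exists>N. \<forall>m\<ge>N. \<forall>n\<ge>N. hnorm (s m - s n) < e) \<Longrightarrow>
     \<exists>l. (\<lambda>n. hnorm (s n - l)) \<longlonglongrightarrow> 0"
begin

definition submodule :: "'x set \<Rightarrow> bool" where
  "submodule Y \<longleftrightarrow> subspace Y \<and> (\<forall>a. \<forall>y\<in>Y. act a y \<in> Y)"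

definition bounded_operator :: "('x \<Rightarrow> 'x) \<Rightarrow> bool" where
  "bounded_operator T \<longleftrightarrow>
     Vector_Spaces.linear scale scale T \<and> (\<exists>K. \<forall>x. hnorm (T x) \<le> K * hnorm x)"

definition bounded_morphism :: "('x \<Rightarrow> 'x) \<Rightarrow> bool" where
  "bounded_morphism T \<longleftrightarrow> bounded_operator T \<and> (\<forall>a x. T (act a x) = act a (T x))"

text \<open>
  The extended action of \<open>d \<in> M(A)\<close>: the continuous extension of \<open>a x \<mapsto> (d a) x\<close>.  It
  exists, and is unique because the products \<open>a x\<close> span a dense subspace of any Hilbert module.
\<close>

definition mact :: "'a multiplier \<Rightarrow> 'x \<Rightarrow> 'x" where
  "mact d = (THE S. bounded_operator S \<and> (\<forall>a x. S (act a x) = act (lmul d a) x))"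

end

locale full_hilbert_module = hilbert_module +
  assumes full: "closure (cvec.span {ip x y | x y. True}) = UNIV"

end

theory Submission
  imports Defs
begin

text \<open>
  Invariance of the submodules \<open>z\<^sup>\<bottom> = {y. \<langle>y, z\<rangle> = 0}\<close> means that \<open>\<langle>x, z\<rangle> = 0\<close> implies \<open>\<langle>Tx, z\<rangle> = 0\<close>.  Let \<open>h = \<langle>x, x\<rangle>\<close>.  If \<open>a\<close>, \<open>b\<close> are functions of \<open>h\<close> with \<open>ab = 0\<close>, then
  \<open>ax \<bottom> bx\<close>, hence \<open>a\<langle>Tx, x\<rangle>b\<^sup>* = 0\<close>.  An element which is local with respect to \<open>h\<close> in this sense
  commutes with \<open>h\<close>: slice \<open>nh\<close> into layers of height \<open>1\<close>; the commutators with the layers are almost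
  orthogonal, so their sum is bounded independently of \<open>n\<close>.  Similarly, testing with vectors orthogonal
  to functions of \<open>h\<close> times \<open>x\<close> gives \<open>\<langle>Tw, x\<rangle>x = \<langle>w, x\<rangle>Tx\<close>, and by polarization
  \<open>\<langle>Tw, y\<rangle>u = \<langle>w, y\<rangle>Tu\<close>.  Therefore \<open>\<langle>w, y\<rangle> \<mapsto> \<langle>Tw, y\<rangle>\<close> extends to a bounded bimodule map \<open>R\<close> of \<open>A\<close>,
  which is the required central multiplier.  Since \<open>T\<close> is onto, uniform boundedness on \<open>X\<close> bounds \<open>R\<close> from
  below; its range is dense and so \<open>R\<close> is invertible.
\<close>

section \<open>Elementary facts on the involution\<close>

text \<open>\<open>A\<close> may lack a unit, so order and spectral arguments run in
  \<open>M(A)\<close>, reached through \<open>embed\<close>. No spectrum appears there: nonnegative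
  elements are recognised by \<open>norm (t *\<^sub>R 1 - p) \<le> t\<close>, and the spectral
  radius is replaced by the growth of the norms of powers, which for self-adjoint elements
  determines the norm.

  The functions of \<open>h\<close> lie in the bicommutant of \<open>h\<close> in
  \<open>M(A)\<close>, while the action on \<open>X\<close> is given for \<open>A\<close> only;
  their products with \<open>h\<close> do lie in \<open>A\<close>. Locality therefore first yields
  identities with surplus factors \<open>h\<close>. Positivity removes them:
  \<open>a * h * star a = 0\<close> means \<open>act a x = 0\<close>, and applying \<open>T\<close>
  or pairing with \<open>T x\<close> turns this into further identities. No adjoint of
  \<open>T\<close> is available for this; module linearity and preservation of orthogonality have to
  do.\<close>

lemma star_zero [simp]: "star (0::'a::cstar_algebra) = 0"
  using star_add[of "0::'a" 0] by simp

lemma star_minus: "star (- a) = - star (a::'a::cstar_algebra)"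
  using star_add[of a "- a"] by (simp add: eq_neg_iff_add_eq_0 add.commute)

lemma star_diff: "star (a - b) = star a - star (b::'a::cstar_algebra)"
  using star_add[of a "- b"] by (simp add: star_minus)

lemma star_scaleR: "star (r *\<^sub>R a) = r *\<^sub>R star (a::'a::cstar_algebra)"
  by (metis scaleC_of_real star_scaleC complex_cnj_complex_of_real)

lemma norm_star: "norm (star a) = norm (a::'a::cstar_algebra)"
proof -
  have le: "norm b \<le> norm (star b)" for b :: 'a
  proof (cases "b = 0")
    case False
    have "norm b * norm b \<le> norm (star b) * norm b"
      using norm_mult_ineq[of "star b" b] by (simp add: norm_star_mult_self power2_eq_square)
    with False show ?thesis by simp
  qed simp
  show ?thesis using le[of a] le[of "star a"] by (simp add: star_star)
qed

lemma norm_mult_star_self: "norm (a * star a) = (norm (a::'a::cstar_algebra))\<^sup>2"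
  using norm_star_mult_self[of "star a"] by (simp add: star_star norm_star)

lemma star_mult_self_eq_0 [simp]: "star a * a = 0 \<longleftrightarrow> (a::'a::cstar_algebra) = 0"
  by (metis norm_star_mult_self norm_eq_zero zero_eq_power2 mult_zero_right)

lemma mult_star_self_eq_0 [simp]: "a * star a = 0 \<longleftrightarrow> (a::'a::cstar_algebra) = 0"
  by (metis norm_mult_star_self norm_eq_zero zero_eq_power2 mult_zero_left)

lemma scaleC_minus_right: "c *\<^sub>C (- a) = - (c *\<^sub>C (a::'a::cstar_algebra))"
  using scaleC_add_right[of c a "- a"] by (simp add: eq_neg_iff_add_eq_0 add.commute)

lemma scaleC_minus_left: "(- c) *\<^sub>C a = - (c *\<^sub>C (a::'a::cstar_algebra))"
proof -
  have "(0::complex) *\<^sub>C a = 0"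
    using scaleC_of_real[of 0 a] by simp
  then show ?thesis
    using scaleC_add_left[of c "- c" a] by (simp add: eq_neg_iff_add_eq_0 add.commute)
qed

definition self_adjoint :: "'a::cstar_algebra \<Rightarrow> bool" where
  "self_adjoint a \<longleftrightarrow> star a = a"

lemma norm_square_self_adjoint:
  "self_adjoint a \<Longrightarrow> norm (a * a) = (norm a)\<^sup>2"
  using norm_star_mult_self[of a] by (simp add: self_adjoint_def)

lemma self_adjoint_square_eq_0: "self_adjoint a \<Longrightarrow> a * a = 0 \<Longrightarrow> a = 0"
  by (metis self_adjoint_def star_mult_self_eq_0)

lemma self_adjoint_zero: "self_adjoint 0"
  and self_adjoint_add: "self_adjoint a \<Longrightarrow> self_adjoint b \<Longrightarrow> self_adjoint (a + b)"
  and self_adjoint_diff: "self_adjoint a \<Longrightarrow> self_adjoint b \<Longrightarrow> self_adjoint (a - b)"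
  and self_adjoint_minus: "self_adjoint a \<Longrightarrow> self_adjoint (- a)"
  and self_adjoint_scaleR: "self_adjoint a \<Longrightarrow> self_adjoint (r *\<^sub>R a)"
  and self_adjoint_mult: "self_adjoint a \<Longrightarrow> self_adjoint b \<Longrightarrow> a * b = b * a \<Longrightarrow> self_adjoint (a * b)"
  and self_adjoint_star_mult: "self_adjoint (star a * a)"
  and self_adjoint_mult_star: "self_adjoint (a * star a)"
  by (simp_all add: self_adjoint_def star_add star_diff star_minus star_scaleR star_mult star_star)


section \<open>Positive elements of a unital C*-algebra\<close>

class cstar_algebra_1 = cstar_algebra + monoid_mult

lemma star_one [simp]: "star (1::'a::cstar_algebra_1) = 1"
  by (metis mult.right_neutral star_mult star_star)

lemma self_adjoint_one: "self_adjoint (1::'a::cstar_algebra_1)"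
  by (simp add: self_adjoint_def)

text \<open>The norm of \<open>1\<close> is \<open>0\<close> in the zero algebra.\<close>

lemma norm_one_le: "norm (1::'a::cstar_algebra_1) \<le> 1"
proof -
  have "norm (1::'a) = (norm (1::'a))\<^sup>2"
    using norm_star_mult_self[of "1::'a"] by simp
  then show ?thesis by (cases "norm (1::'a) = 0") (auto simp: power2_eq_square)
qed

lemma norm_scaleR_one_le: "0 \<le> t \<Longrightarrow> norm (t *\<^sub>R (1::'a::cstar_algebra_1)) \<le> t"
  using mult_left_mono[OF norm_one_le] by fastforce

section \<open>Powers of self-adjoint elements and growth of norms\<close>

lemma self_adjoint_power: "self_adjoint a \<Longrightarrow> self_adjoint (a ^ n)"
  for a :: "'a::cstar_algebra_1"
  by (induction n) (auto simp: self_adjoint_one self_adjoint_mult power_commutes)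

lemma norm_power_le: "0 < n \<Longrightarrow> norm (a ^ n) \<le> norm (a::'a::cstar_algebra_1) ^ n"
proof (induction n)
  case (Suc n)
  show ?case
  proof (cases "n = 0")
    case False
    then have "norm (a ^ n) \<le> norm a ^ n" using Suc by simp
    then show ?thesis
      using norm_mult_ineq[of a "a ^ n"] by (simp add: order_trans mult_left_mono)
  qed simp
qed simp

text \<open>The C*-identity gives equality for the exponents \<open>2 ^ k\<close>. Any other
  \<open>n\<close> is completed to such an exponent:
  \<open>norm a ^ (2 ^ k) \<le> norm (a ^ n) * norm a ^ (2 ^ k - n)\<close> leaves no room for
  strict inequality at \<open>n\<close>.\<close>

lemma norm_power_self_adjoint:
  fixes a :: "'a::cstar_algebra_1"
  assumes a: "self_adjoint a" and n: "0 < n"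
  shows "norm (a ^ n) = norm a ^ n"
proof (rule antisym[OF norm_power_le[OF n]])
  have two: "norm (a ^ (2 ^ k)) = norm a ^ (2 ^ k)" for k
  proof (induction k)
    case (Suc k)
    have "norm (a ^ (2 ^ Suc k)) = (norm (a ^ (2 ^ k)))\<^sup>2"
      using norm_square_self_adjoint[OF self_adjoint_power[OF a, of "2 ^ k"]]
      by (simp add: power_add[symmetric] mult_2)
    with Suc show ?case by (simp add: power_mult[symmetric] mult.commute)
  qed simp
  obtain k where k: "n < 2 ^ k" using less_exp by blast
  show "norm a ^ n \<le> norm (a ^ n)"
  proof (cases "a = 0")
    case False
    have "norm a ^ n * norm a ^ (2 ^ k - n) = norm (a ^ n * a ^ (2 ^ k - n))"
      using k by (simp add: power_add[symmetric] two)
    also have "\<dots> \<le> norm (a ^ n) * norm (a ^ (2 ^ k - n))" by (rule norm_mult_ineq)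
    also have "\<dots> \<le> norm (a ^ n) * norm a ^ (2 ^ k - n)"
      using k by (intro mult_left_mono norm_power_le) auto
    finally show ?thesis using False by simp
  qed (use n in \<open>cases n; simp\<close>)
qed

text \<open>For \<open>q = r / s < 1\<close> even \<open>real (n + 1) * q ^ n\<close> tends to 0.
  The linear factor arises in \<open>nonneg_minus_mult_star\<close>; the other applications produce
  a constant factor.\<close>

lemma linear_over_exponential_bound:
  fixes r s C :: real
  assumes r: "0 \<le> r" and le: "\<And>n. 0 < n \<Longrightarrow> s ^ n \<le> C * real (n + 1) * r ^ n"
  shows "s \<le> r"
proof (rule ccontr)
  assume "\<not> s \<le> r"
  then have s: "r < s" "0 < s" using r by auto
  define q where "q = r / s"
  have q: "0 \<le> q" "q < 1" using s r by (auto simp: q_def)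
  have "(\<lambda>n. real n * q ^ n) \<longlonglongrightarrow> 0"
    using powser_times_n_limit_0[of q] q by simp
  moreover have "(\<lambda>n. q ^ n) \<longlonglongrightarrow> 0" by (rule LIMSEQ_power_zero) (use q in simp)
  ultimately have "(\<lambda>n. C * (real n * q ^ n + q ^ n)) \<longlonglongrightarrow> C * (0 + 0)"
    by (intro tendsto_mult tendsto_add tendsto_const)
  moreover have "1 \<le> C * (real n * q ^ n + q ^ n)" if "n \<ge> 1" for n
  proof -
    have "s ^ n * q ^ n = r ^ n" using s by (simp add: q_def power_divide)
    moreover have "s ^ n * (C * (real n * q ^ n + q ^ n)) = C * real (n + 1) * (s ^ n * q ^ n)"
      by (simp add: algebra_simps)
    ultimately have "s ^ n * 1 \<le> s ^ n * (C * (real n * q ^ n + q ^ n))"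
      using le[of n] that by (metis mult.right_neutral less_le_trans zero_less_one)
    then show ?thesis using s by (simp only: mult_le_cancel_left_pos zero_less_power)
  qed
  ultimately have "1 \<le> C * (0 + 0)" by (intro LIMSEQ_le_const) auto
  then show False by simp
qed

lemma norm_le_of_power_bound:
  fixes a :: "'a::cstar_algebra_1"
  assumes "self_adjoint a" "0 \<le> r" "\<And>n. 0 < n \<Longrightarrow> norm (a ^ n) \<le> C * real (n + 1) * r ^ n"
  shows "norm a \<le> r"
  using linear_over_exponential_bound[of r "norm a" C] assms norm_power_self_adjoint[OF assms(1)]
  by simp

text \<open>Membership in the bicommutant of \<open>h\<close>; it stands in for the functional calculus of \<open>h\<close>.\<close>

definition bicommutes :: "'a::cstar_algebra_1 \<Rightarrow> 'a \<Rightarrow> bool" where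
  "bicommutes h a \<longleftrightarrow> (\<forall>z. z * h = h * z \<longrightarrow> z * a = a * z)"

lemma bicommutes_refl: "bicommutes h h"
  and bicommutes_one: "bicommutes h 1"
  and bicommutes_add: "bicommutes h a \<Longrightarrow> bicommutes h b \<Longrightarrow> bicommutes h (a + b)"
  and bicommutes_diff: "bicommutes h a \<Longrightarrow> bicommutes h b \<Longrightarrow> bicommutes h (a - b)"
  and bicommutes_scaleR: "bicommutes h a \<Longrightarrow> bicommutes h (r *\<^sub>R a)"
  by (auto simp: bicommutes_def algebra_simps)

lemma bicommutes_mult: "bicommutes h a \<Longrightarrow> bicommutes h b \<Longrightarrow> bicommutes h (a * b)"
  unfolding bicommutes_def by (metis mult.assoc)

lemma bicommutes_trans: "bicommutes h a \<Longrightarrow> bicommutes a b \<Longrightarrow> bicommutes h b"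
  unfolding bicommutes_def by metis

lemma bicommutesD: "bicommutes h a \<Longrightarrow> z * h = h * z \<Longrightarrow> z * a = a * z"
  unfolding bicommutes_def by metis

lemma bicommutes_commute: "bicommutes h a \<Longrightarrow> bicommutes h b \<Longrightarrow> a * b = b * a"
  unfolding bicommutes_def by metis

lemmas bicommutes_intros = bicommutes_refl bicommutes_one bicommutes_add bicommutes_diff
  bicommutes_scaleR bicommutes_mult

text \<open>
  The iteration \<open>y \<mapsto> (q + y\<^sup>2) / 2\<close> converges also for \<open>\<parallel>q\<parallel> = 1\<close>, because its increments are
  dominated by those of the scalar iteration for \<open>q = 1\<close>, which increases to \<open>1\<close>.
\<close>

lemma sqrt_one_minus:
  fixes q :: "'a::cstar_algebra_1"
  assumes q: "norm q \<le> 1" "self_adjoint q"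
  shows "\<exists>y. self_adjoint y \<and> norm y \<le> 1 \<and> bicommutes q y \<and> (1 - y) * (1 - y) = 1 - q"
proof -
  define a :: "nat \<Rightarrow> real" where "a = rec_nat 0 (\<lambda>_ x. (1 + x * x) / 2)"
  define y :: "nat \<Rightarrow> 'a" where "y = rec_nat 0 (\<lambda>_ x. (1/2) *\<^sub>R (q + x * x))"
  have a0: "a 0 = 0" and aS: "\<And>n. a (Suc n) = (1 + a n * a n) / 2" by (simp_all add: a_def)
  have y0: "y 0 = 0" and yS: "\<And>n. y (Suc n) = (1/2) *\<^sub>R (q + y n * y n)" by (simp_all add: y_def)
  have a_bd: "0 \<le> a n \<and> a n \<le> 1" for n
  proof (induction n)
    case (Suc n)
    then have "a n * a n \<le> 1" by (simp add: mult_le_one)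
    then show ?case by (simp add: aS add_nonneg_nonneg)
  qed (simp add: a0)
  have y_bd: "norm (y n) \<le> a n" for n
  proof (induction n)
    case (Suc n)
    have "norm (y n * y n) \<le> norm (y n) * norm (y n)" by (rule norm_mult_ineq)
    also have "\<dots> \<le> a n * a n" using Suc by (intro mult_mono) (auto simp: a_bd)
    finally have "norm (q + y n * y n) \<le> 1 + a n * a n"
      using q norm_triangle_ineq[of q "y n * y n"] by linarith
    then show ?case by (simp add: aS yS)
  qed (simp add: a0 y0)
  have step: "norm (y (Suc n) - y n) \<le> a (Suc n) - a n" for n
  proof (induction n)
    case 0
    show ?case using q by (simp add: aS yS a0 y0)
  next
    case (Suc n)
    let ?d = "y (Suc n) - y n"
    have "y (Suc (Suc n)) - y (Suc n) = (1/2) *\<^sub>R (y (Suc n) * ?d + ?d * y n)"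
      by (simp add: yS[of "Suc n"] yS[of n] algebra_simps)
    then have "norm (y (Suc (Suc n)) - y (Suc n)) = norm (y (Suc n) * ?d + ?d * y n) / 2"
      by simp
    also have "\<dots> \<le> (norm (y (Suc n)) * norm ?d + norm ?d * norm (y n)) / 2"
      using norm_triangle_ineq[of "y (Suc n) * ?d" "?d * y n"]
        norm_mult_ineq[of "y (Suc n)" ?d] norm_mult_ineq[of ?d "y n"] by simp
    also have "\<dots> \<le> (a (Suc n) * (a (Suc n) - a n) + (a (Suc n) - a n) * a n) / 2"
      using Suc y_bd[of n] y_bd[of "Suc n"] a_bd[of n] a_bd[of "Suc n"]
        order_trans[OF norm_ge_zero Suc]
      by (intro divide_right_mono add_mono mult_mono) simp_all
    also have "\<dots> = a (Suc (Suc n)) - a (Suc n)"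
      by (simp add: aS[of "Suc n"] aS[of n] field_simps)
    finally show ?case .
  qed
  have tele: "norm (y (n + k) - y n) \<le> a (n + k) - a n" for n k
  proof (induction k)
    case (Suc k)
    have "y (n + Suc k) - y n = (y (Suc (n + k)) - y (n + k)) + (y (n + k) - y n)" by simp
    then have "norm (y (n + Suc k) - y n) \<le> norm (y (Suc (n + k)) - y (n + k)) + norm (y (n + k) - y n)"
      using norm_triangle_ineq by metis
    then show ?case using Suc step[of "n + k"] by simp
  qed simp
  have "incseq a"
    using step by (intro incseq_SucI) (metis norm_ge_zero order_trans diff_ge_0_iff_ge)
  then have "convergent a"
    using a_bd by (intro Bseq_monoseq_convergent BseqI'[of _ 1]) (auto simp: incseq_imp_monoseq)
  then have Ca: "Cauchy a" by (rule convergent_Cauchy)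
  have "Cauchy y"
  proof (rule metric_CauchyI)
    fix e :: real assume "0 < e"
    then obtain N where N: "\<And>m n. m \<ge> N \<Longrightarrow> n \<ge> N \<Longrightarrow> dist (a m) (a n) < e"
      using metric_CauchyD[OF Ca] by blast
    have "dist (y m) (y n) < e" if "n \<le> m" "n \<ge> N" for m n
      using tele[of n "m - n"] N[of m n] that by (simp add: dist_norm)
    then show "\<exists>M. \<forall>m\<ge>M. \<forall>n\<ge>M. dist (y m) (y n) < e"
      by (metis dist_commute nle_le)
  qed
  then obtain l where l: "y \<longlonglongrightarrow> l" using Cauchy_convergent_iff convergent_def by blast
  have "(\<lambda>n. (1/2) *\<^sub>R (q + y n * y n)) \<longlonglongrightarrow> (1/2) *\<^sub>R (q + l * l)"
    by (intro tendsto_intros l)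
  moreover have "(\<lambda>n. (1/2) *\<^sub>R (q + y n * y n)) \<longlonglongrightarrow> l"
    using LIMSEQ_Suc[OF l] by (simp add: yS)
  ultimately have fp: "l = (1/2) *\<^sub>R (q + l * l)" by (rule LIMSEQ_unique[symmetric])
  have y_sa: "self_adjoint (y n)" for n
    by (induction n)
      (simp_all add: y0 yS self_adjoint_zero self_adjoint_add self_adjoint_scaleR self_adjoint_mult q)
  have "norm (star l - l) \<le> e" if e: "e > 0" for e
  proof -
    from l obtain n where n: "norm (y n - l) < e / 2"
      using LIMSEQ_D[OF l, of "e / 2"] e by auto
    have "star l - l = star (l - y n) + (y n - l)"
      using y_sa[of n] by (simp add: star_diff self_adjoint_def)
    then have "norm (star l - l) \<le> norm (l - y n) + norm (y n - l)"
      using norm_triangle_ineq norm_star by metis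
    with n show ?thesis by (simp add: norm_minus_commute)
  qed
  then have "norm (star l - l) \<le> 0" by (rule field_le_epsilon[of _ 0, simplified])
  then have l_sa: "self_adjoint l" by (simp add: self_adjoint_def)
  have "norm (y n) \<le> 1" for n using y_bd[of n] a_bd[of n] by linarith
  then have l_bd: "norm l \<le> 1" using tendsto_norm[OF l] by (intro LIMSEQ_le_const2) auto
  have "bicommutes q l"
    unfolding bicommutes_def
  proof (intro allI impI)
    fix z assume z: "z * q = q * z"
    have "z * y n = y n * z" for n
    proof (induction n)
      case (Suc n)
      then have "z * (y n * y n) = y n * y n * z" by (metis mult.assoc)
      with z show ?case by (simp add: yS algebra_simps)
    qed (simp add: y0)
    moreover have "(\<lambda>n. z * y n) \<longlonglongrightarrow> z * l" "(\<lambda>n. y n * z) \<longlonglongrightarrow> l * z"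
      by (intro tendsto_intros l)+
    ultimately show "z * l = l * z" using LIMSEQ_unique by simp
  qed
  moreover have "(1 - l) * (1 - l) = 1 - q"
  proof -
    have "l + l = q + l * l" using fp by (metis scaleR_half_double scaleR_right_distrib)
    then show ?thesis by (simp add: algebra_simps)
  qed
  ultimately show ?thesis using l_sa l_bd by blast
qed

text \<open>Squares of self-adjoint elements fit the norm criterion below, from which closure under
  addition follows. That \<open>star b * b\<close> has this form is a theorem,
  \<open>nonneg_star_mult\<close>.\<close>

definition nonneg :: "'a::cstar_algebra_1 \<Rightarrow> bool" where
  "nonneg p \<longleftrightarrow> (\<exists>k. self_adjoint k \<and> p = k * k)"

lemma nonneg_square: "self_adjoint k \<Longrightarrow> nonneg (k * k)"
  by (auto simp: nonneg_def)

lemma nonneg_self_adjoint: "nonneg p \<Longrightarrow> self_adjoint p"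
  by (auto simp: nonneg_def self_adjoint_mult)

text \<open>With \<open>c = \<surd>(1 - k\<^sup>2)\<close> the element \<open>u = c + ik\<close> is unitary, and \<open>1 - 2k\<^sup>2\<close> is the real part of \<open>u\<^sup>2\<close>.\<close>

lemma norm_one_minus_double_square:
  fixes k :: "'a::cstar_algebra_1"
  assumes k: "self_adjoint k" "norm k \<le> 1"
  shows "norm (1 - 2 *\<^sub>R (k * k)) \<le> 1"
proof -
  have "norm (k * k) \<le> 1" using k by (simp add: norm_square_self_adjoint power_le_one)
  then obtain y where y: "self_adjoint y" "bicommutes (k * k) y" "(1 - y) * (1 - y) = 1 - k * k"
    using sqrt_one_minus[of "k * k"] k by (auto simp: self_adjoint_mult)
  define c where "c = 1 - y"
  have c: "self_adjoint c" "k * c = c * k" "c * c = 1 - k * k"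
    using y bicommutesD[OF y(2), of k]
    by (simp_all add: c_def self_adjoint_diff self_adjoint_one algebra_simps)
  define u where "u = c + \<i> *\<^sub>C k"
  have su: "star u = c - \<i> *\<^sub>C k"
    using c k by (simp add: u_def star_add star_scaleC self_adjoint_def scaleC_minus_left)
  have ii: "\<i> *\<^sub>C (\<i> *\<^sub>C a) = - a" for a :: 'a
    using scaleC_of_real[of 1 a] by (simp add: scaleC_scaleC scaleC_minus_left)
  have "star u * u = 1"
    unfolding su by (simp add: u_def algebra_simps mult_scaleC_left mult_scaleC_right c ii)
  then have "(norm u)\<^sup>2 \<le> 1\<^sup>2" using norm_star_mult_self[of u] norm_one_le[where 'a='a] by simp
  then have nu: "norm u \<le> 1" by (rule power2_le_imp_le) simp
  have sq: "norm (v * v) \<le> 1" if "norm v \<le> 1" for v :: 'a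
    using norm_mult_ineq[of v v] that mult_le_one[of "norm v" "norm v"] by simp
  have "u * u + star u * star u = 2 *\<^sub>R (c * c - k * k)"
    unfolding su by (simp add: u_def algebra_simps mult_scaleC_left mult_scaleC_right ii scaleR_2)
  also have "\<dots> = 2 *\<^sub>R (1 - 2 *\<^sub>R (k * k))" by (simp add: c scaleR_2 algebra_simps)
  finally have "2 * norm (1 - 2 *\<^sub>R (k * k)) = norm (u * u + star u * star u)" by simp
  also have "\<dots> \<le> 1 + 1"
    using norm_triangle_ineq[of "u * u" "star u * star u"] sq[of u] sq[of "star u"] nu
    by (simp add: norm_star)
  finally show ?thesis by simp
qed

text \<open>Spectrally, \<open>0 \<le> p \<le> 2 * t\<close> places \<open>t - p\<close> between
  \<open>- t\<close> and \<open>t\<close>. For \<open>p = k * k\<close> the scaling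
  \<open>s = sqrt (2 * t)\<close> reduces the claim to \<open>norm_one_minus_double_square\<close>
  for \<open>k / s\<close>. With \<open>nonneg_of_norm_bound\<close> this is the norm criterion for
  positivity.\<close>

lemma nonneg_norm_bound:
  fixes p :: "'a::cstar_algebra_1"
  assumes p: "nonneg p" and t: "norm p \<le> 2 * t"
  shows "norm (t *\<^sub>R 1 - p) \<le> t"
proof -
  obtain k where k: "self_adjoint k" "p = k * k" using p by (auto simp: nonneg_def)
  then have np: "norm p = (norm k)\<^sup>2" by (simp add: norm_square_self_adjoint)
  have t0: "0 \<le> t" using t norm_ge_zero[of p] by linarith
  show ?thesis
  proof (cases "t = 0")
    case True
    with t show ?thesis by simp
  next
    case False
    with t0 have t1: "0 < t" by simp
    define s where "s = sqrt (2 * t)"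
    have s: "0 < s" "s * s = 2 * t" using t1 by (simp_all add: s_def)
    have "norm k \<le> s" using t np by (simp add: s_def real_le_rsqrt)
    then have "norm (1 - 2 *\<^sub>R (((1/s) *\<^sub>R k) * ((1/s) *\<^sub>R k))) \<le> 1"
      using s k by (intro norm_one_minus_double_square) (auto simp: self_adjoint_scaleR)
    moreover have "1 - 2 *\<^sub>R (((1/s) *\<^sub>R k) * ((1/s) *\<^sub>R k)) = (1/t) *\<^sub>R (t *\<^sub>R 1 - p)"
      using s t1 k by (simp add: scaleR_diff_right)
    ultimately have "norm ((1/t) *\<^sub>R (t *\<^sub>R 1 - p)) \<le> 1" by metis
    then show ?thesis using t1 by simp
  qed
qed

text \<open>The bound makes \<open>q = 1 - p / t\<close> a contraction, so
  \<open>sqrt_one_minus\<close> applies. The form of \<open>k\<close> is kept because it shows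
  \<open>norm (s *\<^sub>R 1 - k) \<le> s\<close>, from which \<open>nonneg_root\<close> concludes
  that the root itself is nonnegative.\<close>

lemma nonneg_root_of_norm_bound:
  fixes p :: "'a::cstar_algebra_1"
  assumes p: "self_adjoint p" "norm (t *\<^sub>R 1 - p) \<le> t" and s: "s = sqrt t"
  shows "\<exists>k y. self_adjoint k \<and> bicommutes p k \<and> p = k * k \<and>
           k = s *\<^sub>R (1 - y) \<and> norm y \<le> 1"
proof -
  have t0: "0 \<le> t" using p(2) norm_ge_zero order_trans by blast
  show ?thesis
  proof (cases "t = 0")
    case True
    with p have "p = 0" by simp
    then show ?thesis using True s
      by (intro exI[of _ 0] exI[of _ 0]) (auto simp: self_adjoint_zero bicommutes_refl)
  next
    case False
    with t0 have t1: "0 < t" by simp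
    define q where "q = 1 - (1/t) *\<^sub>R p"
    have "q = (1/t) *\<^sub>R (t *\<^sub>R 1 - p)" using t1 by (simp add: q_def scaleR_diff_right)
    then have "norm q \<le> 1" using p t1 by simp
    moreover have "self_adjoint q"
      by (simp add: q_def self_adjoint_diff self_adjoint_one self_adjoint_scaleR p)
    ultimately obtain y where y: "self_adjoint y" "norm y \<le> 1" "bicommutes q y"
      "(1 - y) * (1 - y) = 1 - q"
      using sqrt_one_minus by blast
    have "bicommutes p y"
      using y(3) by (rule bicommutes_trans[rotated]) (auto simp: q_def intro!: bicommutes_intros)
    then have "bicommutes p (s *\<^sub>R (1 - y))" by (intro bicommutes_intros)
    moreover have "s *\<^sub>R (1 - y) * s *\<^sub>R (1 - y) = p"
      using t1 s by (simp add: y q_def)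
    ultimately show ?thesis
      using y t1 s
      by (intro exI[of _ "s *\<^sub>R (1 - y)"] exI[of _ y])
        (auto simp: self_adjoint_scaleR self_adjoint_diff self_adjoint_one)
  qed
qed

lemma nonneg_of_norm_bound:
  "self_adjoint p \<Longrightarrow> norm (t *\<^sub>R 1 - p) \<le> t \<Longrightarrow> nonneg (p :: 'a::cstar_algebra_1)"
  using nonneg_root_of_norm_bound by (metis nonneg_def)

lemma nonneg_root:
  assumes "nonneg p"
  obtains k where "nonneg k" "bicommutes p k" "p = k * k"
proof -
  have "norm (norm p *\<^sub>R 1 - p) \<le> norm p" by (rule nonneg_norm_bound[OF assms]) simp
  then obtain k y where k: "self_adjoint k" "bicommutes p k" "p = k * k" "norm y \<le> 1"
    "k = sqrt (norm p) *\<^sub>R (1 - y)"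
    using nonneg_root_of_norm_bound[OF nonneg_self_adjoint[OF assms]] by metis
  have "sqrt (norm p) *\<^sub>R 1 - k = sqrt (norm p) *\<^sub>R y"
    by (simp add: k(5) scaleR_diff_right)
  then have "norm (sqrt (norm p) *\<^sub>R 1 - k) \<le> sqrt (norm p)"
    using k(4) by (simp add: mult_left_le)
  then have "nonneg k" by (rule nonneg_of_norm_bound[OF k(1)])
  with k that show ?thesis by blast
qed

text \<open>The criterion \<open>norm (t *\<^sub>R 1 - p) \<le> t\<close> is additive in
  \<open>t\<close> and \<open>p\<close>.\<close>

lemma nonneg_add:
  fixes p q :: "'a::cstar_algebra_1"
  assumes "nonneg p" "nonneg q"
  shows "nonneg (p + q)"
proof (rule nonneg_of_norm_bound)
  show "self_adjoint (p + q)" by (simp add: assms nonneg_self_adjoint self_adjoint_add)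
  have eq: "(norm p + norm q) *\<^sub>R 1 - (p + q) = (norm p *\<^sub>R 1 - p) + (norm q *\<^sub>R 1 - q)"
    by (simp add: algebra_simps)
  have "norm (norm p *\<^sub>R 1 - p) \<le> norm p" "norm (norm q *\<^sub>R 1 - q) \<le> norm q"
    by (auto intro!: nonneg_norm_bound assms)
  then show "norm ((norm p + norm q) *\<^sub>R 1 - (p + q)) \<le> norm p + norm q"
    unfolding eq by (intro norm_triangle_le) simp
qed

lemma nonneg_scaleR: "nonneg p \<Longrightarrow> 0 \<le> r \<Longrightarrow> nonneg (r *\<^sub>R p)"
proof -
  assume "nonneg p" "0 \<le> r"
  then obtain k where k: "self_adjoint k" "p = k * k" by (auto simp: nonneg_def)
  have "nonneg ((sqrt r *\<^sub>R k) * (sqrt r *\<^sub>R k))"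
    by (intro nonneg_square self_adjoint_scaleR k)
  with k \<open>0 \<le> r\<close> show ?thesis by simp
qed

lemma nonneg_one: "nonneg 1"
  using nonneg_square[OF self_adjoint_one] by simp

lemma nonneg_mult:
  assumes "nonneg p" "nonneg q" "p * q = q * p"
  shows "nonneg (p * q)"
proof -
  obtain k where k: "nonneg k" "bicommutes p k" "p = k * k" using nonneg_root assms by blast
  obtain l where l: "nonneg l" "bicommutes q l" "q = l * l" using nonneg_root assms by blast
  have "k * q = q * k" using bicommutesD[OF k(2), of q] assms by simp
  then have kl: "k * l = l * k" using bicommutesD[OF l(2), of k] by simp
  have "p * q = (k * l) * (k * l)" using kl k l by (metis mult.assoc)
  then show ?thesis
    using nonneg_square[of "k * l"] k l kl by (simp add: self_adjoint_mult nonneg_self_adjoint)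
qed

section \<open>Comparison of order and norm\<close>

lemma nonneg_antisym:
  assumes "nonneg p" "nonneg (- p)"
  shows "p = (0 :: 'a::cstar_algebra_1)"
proof -
  let ?t = "norm p / 2"
  have 1: "norm (?t *\<^sub>R 1 - p) \<le> ?t" "norm (?t *\<^sub>R 1 - - p) \<le> ?t"
    by (rule nonneg_norm_bound; use assms in simp)+
  have "2 *\<^sub>R p = (?t *\<^sub>R 1 - - p) - (?t *\<^sub>R 1 - p)" by (simp add: scaleR_2)
  then have "norm (2 *\<^sub>R p) \<le> norm (?t *\<^sub>R 1 - - p) + norm (?t *\<^sub>R 1 - p)"
    using norm_triangle_ineq4 by metis
  with 1 have "norm (2 *\<^sub>R p) \<le> norm p" by linarith
  then show ?thesis by simp
qed

lemma nonneg_add_eq_0: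
  assumes "nonneg p" "nonneg q" "p + q = 0"
  shows "p = 0" "q = (0 :: 'a::cstar_algebra_1)"
proof -
  have "q = - p" using assms(3) by (simp add: eq_neg_iff_add_eq_0 add.commute)
  then show "p = 0" using nonneg_antisym assms by blast
  with assms(3) show "q = 0" by simp
qed

lemma nonneg_norm_minus: "nonneg p \<Longrightarrow> norm p \<le> r \<Longrightarrow> nonneg (r *\<^sub>R 1 - p)"
  by (rule nonneg_of_norm_bound[of _ r])
    (simp_all add: self_adjoint_diff self_adjoint_scaleR self_adjoint_one nonneg_self_adjoint)

text \<open>Spectrally, adding \<open>s\<close> shifts the largest spectral value. The criterion
  with \<open>t = norm (q + r *\<^sub>R 1) / 2\<close> proves this for small shifts, where
  \<open>3 * r \<le> norm q\<close> keeps \<open>t - r\<close> nonnegative; a large shift is cut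
  into \<open>n\<close> small ones. The assumption \<open>p \<noteq> 0\<close> rules out the zero
  algebra.\<close>

lemma norm_add_scaleR_one:
  fixes p :: "'a::cstar_algebra_1"
  assumes p: "nonneg p" and s: "0 \<le> s" and p0: "p \<noteq> 0"
  shows "norm p + s \<le> norm (p + s *\<^sub>R 1)"
proof -
  have small: "norm q + r \<le> norm (q + r *\<^sub>R 1)" if q: "nonneg q" and r: "0 \<le> r" "3 * r \<le> norm q"
    for q :: 'a and r :: real
  proof -
    let ?N = "norm (q + r *\<^sub>R 1)"
    have "nonneg (q + r *\<^sub>R 1)" by (intro nonneg_add nonneg_scaleR nonneg_one q r)
    then have 1: "norm ((?N / 2) *\<^sub>R 1 - (q + r *\<^sub>R 1)) \<le> ?N / 2"
      by (rule nonneg_norm_bound) simp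
    have "norm q \<le> ?N + norm (r *\<^sub>R (1::'a))"
      using norm_triangle_ineq4[of "q + r *\<^sub>R 1" "r *\<^sub>R 1"] by simp
    then have N: "2 * r \<le> ?N" using norm_scaleR_one_le[of r, where 'a='a] r by linarith
    have "q = (?N / 2 - r) *\<^sub>R 1 - ((?N / 2) *\<^sub>R 1 - (q + r *\<^sub>R 1))"
      by (simp add: algebra_simps)
    then have "norm q \<le> norm ((?N / 2 - r) *\<^sub>R (1::'a)) + norm ((?N / 2) *\<^sub>R 1 - (q + r *\<^sub>R 1))"
      using norm_triangle_ineq4 by metis
    also have "\<dots> \<le> (?N / 2 - r) + ?N / 2"
      using 1 N by (intro add_mono norm_scaleR_one_le) auto
    finally show ?thesis by simp
  qed
  obtain n where n: "3 * s \<le> real n * norm p" "0 < n"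
  proof -
    obtain n where n: "3 * s / norm p < real n" using reals_Archimedean2 by blast
    moreover have "0 \<le> 3 * s / norm p" using s by simp
    ultimately have "0 < real n" by linarith
    with n show ?thesis using p0 by (intro that[of n]) (auto simp: field_simps)
  qed
  define r where "r = s / real n"
  have r: "0 \<le> r" "3 * r \<le> norm p" using s n by (auto simp: r_def field_simps)
  have "norm p + real j * r \<le> norm (p + (real j * r) *\<^sub>R 1)" for j
  proof (induction j)
    case (Suc j)
    have "nonneg (p + (real j * r) *\<^sub>R 1)" using r by (intro nonneg_add nonneg_scaleR nonneg_one p) auto
    moreover have "3 * r \<le> norm (p + (real j * r) *\<^sub>R 1)"
      using Suc r mult_nonneg_nonneg[of "real j" r] by linarith
    ultimately have "norm (p + (real j * r) *\<^sub>R 1) + r \<le> norm (p + (real j * r) *\<^sub>R 1 + r *\<^sub>R 1)"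
      using small r by blast
    with Suc show ?case by (simp add: algebra_simps)
  qed simp
  from this[of n] show ?thesis using n by (simp add: r_def)
qed

text \<open>With \<open>r = norm q\<close>, the element \<open>r - p\<close> is nonnegative. The
  criterion for it with a large \<open>t\<close> bounds the norm of \<open>p + (t - r)\<close> by
  \<open>t\<close>, and \<open>norm_add_scaleR_one\<close> cancels the shift
  \<open>t - r\<close>.\<close>

lemma norm_mono_nonneg:
  fixes p q :: "'a::cstar_algebra_1"
  assumes "nonneg p" "nonneg (q - p)"
  shows "norm p \<le> norm q"
proof (cases "p = 0")
  case False
  let ?r = "norm q"
  have "nonneg q" using nonneg_add[OF assms] by simp
  then have "nonneg (?r *\<^sub>R 1 - q)" by (rule nonneg_norm_minus) simp
  from nonneg_add[OF this assms(2)] have m: "nonneg (?r *\<^sub>R 1 - p)" by simp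
  define t where "t = ?r + norm (?r *\<^sub>R 1 - p)"
  have "norm (t *\<^sub>R 1 - (?r *\<^sub>R 1 - p)) \<le> t"
    by (rule nonneg_norm_bound[OF m]) (simp add: t_def)
  moreover have "t *\<^sub>R 1 - (?r *\<^sub>R 1 - p) = p + (t - ?r) *\<^sub>R 1" by (simp add: algebra_simps)
  moreover have "norm p + (t - ?r) \<le> norm (p + (t - ?r) *\<^sub>R 1)"
    by (rule norm_add_scaleR_one[OF assms(1) _ False]) (simp add: t_def)
  ultimately show ?thesis by simp
qed simp

text \<open>
  The spectra of \<open>c\<^sup>*c\<close> and \<open>cc\<^sup>*\<close> agree up to \<open>0\<close>.  Here this is replaced by a comparison of the
  powers of \<open>t + c\<^sup>*c\<close> and \<open>t + cc\<^sup>*\<close>.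
\<close>

lemma nonneg_minus_mult_star:
  fixes c :: "'a::cstar_algebra_1"
  assumes "nonneg (- (star c * c))"
  shows "nonneg (- (c * star c))"
proof -
  define t where "t = (norm c)\<^sup>2"
  have t0: "0 \<le> t" by (simp add: t_def)
  define B where "B = t *\<^sub>R 1 + star c * c"
  define C where "C = t *\<^sub>R 1 + c * star c"
  have B: "norm B \<le> t"
    using nonneg_norm_bound[OF assms, of t] by (simp add: B_def t_def norm_star_mult_self)
  have cB: "C * c = c * B" by (simp add: B_def C_def algebra_simps)
  \<comment> \<open>Since \<open>C * c = c * B\<close>, powers of \<open>C\<close> pass through
    \<open>c\<close>, and the middle factor obeys \<open>S' = t ^ n + B * S\<close>. As
    \<open>norm B \<le> t\<close>, it grows like \<open>n * t ^ (n - 1)\<close>; the factor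
    \<open>t\<close> in the bound avoids the exponent \<open>n - 1\<close>.\<close>
  have ex: "\<exists>S. C ^ n = t ^ n *\<^sub>R 1 + c * S * star c \<and> t * norm S \<le> real n * t ^ n" for n
  proof (induction n)
    case 0
    show ?case by (intro exI[of _ 0]) simp
  next
    case (Suc n)
    then obtain S where S: "C ^ n = t ^ n *\<^sub>R 1 + c * S * star c" "t * norm S \<le> real n * t ^ n"
      by blast
    let ?S = "t ^ n *\<^sub>R 1 + B * S"
    have "C ^ Suc n = t ^ n *\<^sub>R C + (C * c) * S * star c"
      by (simp add: S algebra_simps)
    also have "\<dots> = t ^ Suc n *\<^sub>R 1 + c * ?S * star c"
      unfolding cB by (simp add: C_def algebra_simps)
    finally have 1: "C ^ Suc n = t ^ Suc n *\<^sub>R 1 + c * ?S * star c" .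
    have "norm (B * S) \<le> t * norm S"
      using norm_mult_ineq[of B S] B by (meson mult_right_mono norm_ge_zero order_trans)
    then have "norm ?S \<le> t ^ n + real n * t ^ n"
      using norm_triangle_ineq[of "t ^ n *\<^sub>R 1" "B * S"] S(2)
        norm_scaleR_one_le[of "t ^ n", where 'a='a] t0 by (smt (verit) zero_le_power)
    then have "t * norm ?S \<le> t * (t ^ n + real n * t ^ n)" using t0 by (rule mult_left_mono)
    with 1 show ?case by (intro exI[of _ ?S]) (simp add: algebra_simps)
  qed
  have pow: "norm (C ^ n) \<le> 1 * real (n + 1) * t ^ n" for n
  proof -
    obtain S where S: "C ^ n = t ^ n *\<^sub>R 1 + c * S * star c" "t * norm S \<le> real n * t ^ n"
      using ex by blast
    have "norm (c * S * star c) \<le> norm c * norm S * norm c"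
      using norm_mult_ineq[of "c * S" "star c"] norm_mult_ineq[of c S]
      by (metis norm_star mult_right_mono norm_ge_zero order_trans)
    also have "\<dots> = t * norm S" by (simp add: t_def power2_eq_square)
    finally show ?thesis
      using S norm_triangle_ineq[of "t ^ n *\<^sub>R 1" "c * S * star c"]
        norm_scaleR_one_le[of "t ^ n", where 'a='a] t0 by (simp add: algebra_simps)
  qed
  have "self_adjoint C"
    by (simp add: C_def self_adjoint_add self_adjoint_scaleR self_adjoint_one self_adjoint_mult_star)
  then have "norm C \<le> t" by (rule norm_le_of_power_bound[OF _ t0 pow])
  then show ?thesis
    by (intro nonneg_of_norm_bound[of _ t]) (simp_all add: C_def self_adjoint_minus self_adjoint_mult_star)
qed

text \<open>Up to sign, \<open>x\<close> and \<open>y\<close> are twice the real and imaginary parts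
  of \<open>c\<close>. Their squares make \<open>star c * c + c * star c\<close> nonnegative, and
  \<open>nonneg_minus_mult_star\<close> removes the second summand; \<open>star c * c\<close> then
  has both signs.\<close>

lemma nonneg_minus_star_mult_imp_zero:
  fixes c :: "'a::cstar_algebra_1"
  assumes "nonneg (- (star c * c))"
  shows "c = 0"
proof -
  define x where "x = c + star c"
  define y where "y = \<i> *\<^sub>C (c - star c)"
  have ii: "\<i> *\<^sub>C (\<i> *\<^sub>C a) = - a" for a :: 'a
    using scaleC_of_real[of 1 a] by (simp add: scaleC_scaleC scaleC_minus_left)
  have x: "self_adjoint x" by (simp add: self_adjoint_def x_def star_add star_star)
  have y: "self_adjoint y"
    by (simp add: self_adjoint_def y_def star_diff star_star star_scaleC scaleC_minus_left
        scaleC_minus_right[symmetric])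
  have "x * x + y * y = 2 *\<^sub>R (star c * c + c * star c)"
    by (simp add: x_def y_def mult_scaleC_left mult_scaleC_right ii scaleR_2 algebra_simps)
  then have "nonneg (2 *\<^sub>R (star c * c + c * star c))"
    using nonneg_add[OF nonneg_square[OF x] nonneg_square[OF y]] by simp
  then have "nonneg (star c * c + c * star c)"
    using nonneg_scaleR[of "2 *\<^sub>R (star c * c + c * star c)" "1/2"] by simp
  from nonneg_add[OF this nonneg_minus_mult_star[OF assms]] have "nonneg (star c * c)" by simp
  then have "star c * c = 0" using assms by (rule nonneg_antisym)
  then show ?thesis by simp
qed

text \<open>With \<open>a = |h|\<close> and \<open>g\<close> its root, \<open>v = a - h\<close> is
  twice the negative part of \<open>h\<close>. Then
  \<open>star (b * v) * (b * v) = v * h * v\<close> is the negative of the square of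
  \<open>g * v\<close>, so the preceding lemma gives \<open>b * v = 0\<close>; hence
  \<open>v = 0\<close> and \<open>h = |h|\<close>.\<close>

lemma nonneg_star_mult: "nonneg (star b * (b :: 'a::cstar_algebra_1))"
proof -
  define h where "h = star b * b"
  have h: "self_adjoint h" by (simp add: h_def self_adjoint_star_mult)
  obtain a where a: "nonneg a" "bicommutes (h * h) a" "h * h = a * a"
    using nonneg_root nonneg_square[OF h] by metis
  obtain g where g: "nonneg g" "bicommutes a g" "a = g * g" using nonneg_root a by metis
  have ha: "h * a = a * h" using bicommutesD[OF a(2), of h] by (simp add: mult.assoc)
  have hg: "h * g = g * h" using bicommutesD[OF g(2) ha] .
  define v where "v = a - h"
  have v: "self_adjoint v" by (simp add: v_def self_adjoint_diff nonneg_self_adjoint a h)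
  have hv: "h * v = - (a * v)" by (simp add: v_def algebra_simps a(3) ha)
  have gv: "g * v = v * g" by (simp add: v_def algebra_simps hg) (simp add: g(3) mult.assoc)
  have gv': "self_adjoint (g * v)" using gv g v by (simp add: self_adjoint_mult nonneg_self_adjoint)
  have "star (b * v) * (b * v) = v * (h * v)"
    using v by (simp add: star_mult self_adjoint_def h_def mult.assoc)
  also have "\<dots> = - (v * (g * g) * v)" by (simp add: hv g(3) mult.assoc)
  also have "v * (g * g) * v = (g * v) * (g * v)" by (metis gv mult.assoc)
  finally have bv: "star (b * v) * (b * v) = - ((g * v) * (g * v))" .
  then have "nonneg (- (star (b * v) * (b * v)))" using nonneg_square[OF gv'] by simp
  then have "b * v = 0" by (rule nonneg_minus_star_mult_imp_zero)
  then have "g * v = 0" using bv self_adjoint_square_eq_0[OF gv'] by simp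
  then have "a * v = 0" by (simp add: g(3) mult.assoc)
  with hv have "v * v = 0" by (simp add: v_def algebra_simps)
  then have "v = 0" using self_adjoint_square_eq_0[OF v] by simp
  then have "h = a" by (simp add: v_def)
  with a show ?thesis by (simp add: h_def)
qed

lemma nonneg_conj:
  assumes "nonneg p"
  shows "nonneg (star c * p * c)"
proof -
  obtain k where k: "self_adjoint k" "p = k * k" using assms by (auto simp: nonneg_def)
  then have "star c * p * c = star (k * c) * (k * c)"
    by (simp add: star_mult self_adjoint_def mult.assoc)
  then show ?thesis by (simp add: nonneg_star_mult)
qed

text \<open>Sandwiched by \<open>s\<close>, both terms become nonnegative with sum 0, so each
  vanishes; \<open>s * p * s = 0\<close> forces \<open>k * s = 0\<close> for the root
  \<open>k\<close> of \<open>p\<close>.\<close>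

lemma nonneg_mult_eq_0:
  fixes a b s :: "'a::cstar_algebra_1"
  assumes a: "nonneg a" and b: "nonneg b" and s: "self_adjoint s" and z: "(a + b) * s = 0"
  shows "a * s = 0" "b * s = 0"
proof -
  have "s * a * s + s * b * s = s * ((a + b) * s)" by (simp add: algebra_simps)
  then have sum: "s * a * s + s * b * s = 0" using z by simp
  have "nonneg (s * a * s)" "nonneg (s * b * s)"
    using nonneg_conj[OF a, of s] nonneg_conj[OF b, of s] s by (simp_all add: self_adjoint_def)
  from nonneg_add_eq_0[OF this sum] have sas: "s * a * s = 0" "s * b * s = 0" .
  have *: "p * s = 0" if p: "nonneg p" "s * p * s = 0" for p :: 'a
  proof -
    obtain k where k: "nonneg k" "p = k * k" using nonneg_root p(1) by blast
    then have "star (k * s) * (k * s) = s * p * s"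
      using nonneg_self_adjoint[OF k(1)] s by (simp add: star_mult self_adjoint_def mult.assoc)
    with p have "k * s = 0" by (metis star_mult_self_eq_0)
    then show ?thesis by (simp add: k mult.assoc)
  qed
  show "a * s = 0" "b * s = 0" using *[OF a sas(1)] *[OF b sas(2)] .
qed

text \<open>
  Take \<open>u = (w + h) / 2\<close> and \<open>v = (w - h) / 2\<close> with \<open>w = |h|\<close>.  Positivity of \<open>u\<close> and \<open>v\<close> is obtained
  from \<open>|u| + |v| = w = u + v\<close>, where the first equality is the uniqueness of positive square roots.
\<close>

lemma positive_negative_parts:
  fixes h :: "'a::cstar_algebra_1"
  assumes h: "self_adjoint h"
  obtains u v where "nonneg u" "nonneg v" "bicommutes h u" "bicommutes h v" "h = u - v" "u * v = 0"
proof -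
  obtain w where w: "nonneg w" "bicommutes (h * h) w" "h * h = w * w"
    using nonneg_root nonneg_square[OF h] by metis
  have bhh: "bicommutes h (h * h)" by (intro bicommutes_intros)
  have hw: "bicommutes h w" using bicommutes_trans[OF bhh w(2)] .
  have comm: "h * w = w * h" using bicommutes_commute[OF bicommutes_refl hw] .
  have abs: "\<exists>c. nonneg c \<and> c * c = a * a \<and> bicommutes h c"
    if a: "self_adjoint a" "bicommutes h a" for a
  proof -
    obtain c where c: "nonneg c" "bicommutes (a * a) c" "a * a = c * c"
      using nonneg_root nonneg_square[OF a(1)] by metis
    have "bicommutes h (a * a)" using a by (intro bicommutes_intros)
    with c show ?thesis using bicommutes_trans by metis
  qed
  define u where "u = (1/2) *\<^sub>R (w + h)"
  define v where "v = (1/2) *\<^sub>R (w - h)"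
  have uv_sa: "self_adjoint u" "self_adjoint v"
    using nonneg_self_adjoint[OF w(1)] h
    by (simp_all add: u_def v_def self_adjoint_scaleR self_adjoint_add self_adjoint_diff)
  have uv_b: "bicommutes h u" "bicommutes h v"
    by (auto simp: u_def v_def intro!: bicommutes_intros hw)
  have uv: "u * v = 0"
    by (simp add: u_def v_def algebra_simps comm w(3))
  obtain a where a: "nonneg a" "a * a = u * u" "bicommutes h a" using abs[OF uv_sa(1) uv_b(1)] by blast
  obtain b where b: "nonneg b" "b * b = v * v" "bicommutes h b" using abs[OF uv_sa(2) uv_b(2)] by blast
  have zero: "c * d = 0"
    if "self_adjoint c" "self_adjoint d" "bicommutes h c" "bicommutes h d"
       "c * c = u * u" "d * d = v * v" for c d
  proof -
    have cd: "c * d = d * c" using bicommutes_commute that by blast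
    have "(c * d) * (c * d) = (c * c) * (d * d)" using cd by (metis mult.assoc)
    also have "\<dots> = u * (u * v) * v" using that by (simp add: mult.assoc)
    finally show ?thesis
      using self_adjoint_square_eq_0[OF self_adjoint_mult[OF that(1,2) cd]] uv by simp
  qed
  note sa = nonneg_self_adjoint[OF a(1)] nonneg_self_adjoint[OF b(1)]
  have ab: "a * b = 0" "a * v = 0" "u * b = 0"
    using zero a b sa uv_sa uv_b by blast+
  have ab': "b * a = 0" "v * a = 0" "b * u = 0" "v * u = 0"
    using ab uv bicommutes_commute a b uv_b by metis+
  have wuv: "w = u + v" by (simp add: u_def v_def scaleR_2[symmetric] scaleR_add_right[symmetric])
  have "(w - (a + b)) * (w + (a + b)) = 0"
    using bicommutes_commute[OF uv_b(1) a(3)] bicommutes_commute[OF uv_b(2) b(3)]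
    by (simp add: wuv algebra_simps ab ab' uv a b)
  then have "(w + (a + b)) * (w - (a + b)) = 0"
    using bicommutes_commute[of h "w - (a + b)" "w + (a + b)"] hw a b
    by (simp add: bicommutes_intros)
  moreover have sa_d: "self_adjoint (w - (a + b))"
    by (intro self_adjoint_diff self_adjoint_add nonneg_self_adjoint w a b)
  ultimately have "w * (w - (a + b)) = 0" "(a + b) * (w - (a + b)) = 0"
    using nonneg_mult_eq_0[OF w(1) nonneg_add[OF a(1) b(1)]] by auto
  then have "(w - (a + b)) * (w - (a + b)) = 0" by (simp only: left_diff_distrib) simp
  then have "w = a + b" using self_adjoint_square_eq_0[OF sa_d] by simp
  then have s: "a - u = v - b" using wuv by (simp add: algebra_simps)
  \<comment> \<open>\<open>a - u\<close> and \<open>v - b\<close> are equal, yet their product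
    vanishes because \<open>a\<close> and \<open>u\<close> annihilate \<open>v\<close> and
    \<open>b\<close>.\<close>
  have "(a - u) * (a - u) = (a - u) * (v - b)" by (simp only: s)
  also have "\<dots> = 0" by (simp add: algebra_simps ab ab' uv)
  finally have "a = u"
    using self_adjoint_square_eq_0[of "a - u"] sa uv_sa by (simp add: self_adjoint_diff)
  with s have "b = v" by simp
  have "h = u - v" by (simp add: u_def v_def scaleR_2[symmetric] scaleR_diff_right[symmetric])
  with \<open>a = u\<close> \<open>b = v\<close> a b uv that show ?thesis by blast
qed

section \<open>Truncation and resolvents\<close>

lemma nonneg_commuting_product_le:
  fixes p q :: "'a::cstar_algebra_1"
  assumes "nonneg p" "nonneg q" "p * q = q * p"
  shows "nonneg (norm p *\<^sub>R q - p * q)"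
proof -
  have "nonneg ((norm p *\<^sub>R 1 - p) * q)"
    using assms by (intro nonneg_mult nonneg_norm_minus) (auto simp: algebra_simps)
  then show ?thesis by (simp add: algebra_simps)
qed

text \<open>Monotonicity of the norm compares \<open>p * p\<close> with
  \<open>r *\<^sub>R p\<close>. For \<open>r < 0\<close> the hypothesis makes
  \<open>- (p * p)\<close> nonnegative, so \<open>p = 0\<close>; hence the
  \<open>max\<close>.\<close>

lemma norm_le_of_square_le:
  fixes p :: "'a::cstar_algebra_1"
  assumes p: "nonneg p" and r: "nonneg (r *\<^sub>R p - p * p)"
  shows "norm p \<le> max 0 r"
proof (cases "0 \<le> r \<and> p \<noteq> 0")
  case True
  have "norm (p * p) \<le> norm (r *\<^sub>R p)"
    by (rule norm_mono_nonneg[OF nonneg_square[OF nonneg_self_adjoint[OF p]] r])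
  then have "norm p * norm p \<le> r * norm p"
    using True norm_square_self_adjoint[OF nonneg_self_adjoint[OF p]] by (simp add: power2_eq_square)
  with True show ?thesis by simp
next
  case False
  have "p = 0" if "r < 0"
  proof -
    have "nonneg ((- r) *\<^sub>R p)" using p that by (intro nonneg_scaleR) auto
    from nonneg_add[OF r this] have "nonneg (- (p * p))" by simp
    then have "p * p = 0" by (rule nonneg_antisym[OF nonneg_square[OF nonneg_self_adjoint[OF p]]])
    then show ?thesis using self_adjoint_square_eq_0 nonneg_self_adjoint[OF p] by blast
  qed
  with False show ?thesis by force
qed

text \<open>\<open>u = (f - r)\<^sup>+\<close> and \<open>v = (f - r)\<^sup>-\<close>.\<close>

lemma truncation:
  fixes f :: "'a::cstar_algebra_1"
  assumes f: "nonneg f" and r: "0 \<le> r"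
  obtains u v where "nonneg u" "nonneg v" "bicommutes f u" "bicommutes f v"
    "f - r *\<^sub>R 1 = u - v" "u * v = 0" "norm v \<le> r" "norm u \<le> max 0 (norm f - r)"
proof -
  have "self_adjoint (f - r *\<^sub>R 1)"
    by (intro self_adjoint_diff self_adjoint_scaleR self_adjoint_one nonneg_self_adjoint f)
  then obtain u v where uv: "nonneg u" "nonneg v" "bicommutes (f - r *\<^sub>R 1) u"
    "bicommutes (f - r *\<^sub>R 1) v" "f - r *\<^sub>R 1 = u - v" "u * v = 0"
    by (rule positive_negative_parts)
  have "bicommutes f (f - r *\<^sub>R 1)" by (intro bicommutes_intros)
  then have b: "bicommutes f u" "bicommutes f v" using bicommutes_trans uv by blast+
  have vu: "v * u = 0" using bicommutes_commute[OF b] uv by simp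
  have fe: "f = r *\<^sub>R 1 + u - v" using uv(5) by (simp add: algebra_simps)
  have fu: "f * u = u * f" "f * v = v * f" using b bicommutes_commute bicommutes_refl by blast+
  have "nonneg (f * v)" by (rule nonneg_mult[OF f uv(2) fu(2)])
  moreover have "f * v = r *\<^sub>R v - v * v" by (simp add: fe algebra_simps uv)
  ultimately have v: "norm v \<le> r" using norm_le_of_square_le[OF uv(2), of r] r by simp
  have "nonneg (norm f *\<^sub>R u - f * u)" by (rule nonneg_commuting_product_le[OF f uv(1) fu(1)])
  moreover have "norm f *\<^sub>R u - f * u = (norm f - r) *\<^sub>R u - u * u"
  proof -
    have "f * u = r *\<^sub>R u + u * u" by (subst fe) (simp add: algebra_simps vu)
    then show ?thesis by (simp add: algebra_simps)
  qed
  ultimately have "norm u \<le> max 0 (norm f - r)" using norm_le_of_square_le[OF uv(1)] by simp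
  with v uv b that show ?thesis by blast
qed

text \<open>Here \<open>p + e = t * (1 - q)\<close> with \<open>t = norm p + e\<close> and
  \<open>norm q < 1\<close>. Banach fixed points of \<open>y = 1/t + q * y\<close> and
  \<open>y = 1/t + y * q\<close> replace the Neumann series and give a right and a left inverse,
  which coincide. Estimating the first equation with \<open>norm q \<le> norm p / t\<close> yields
  \<open>1 / e\<close>.\<close>

lemma resolvent:
  fixes p :: "'a::cstar_algebra_1"
  assumes p: "nonneg p" and e: "0 < e"
  obtains y where "y * (p + e *\<^sub>R 1) = 1" "(p + e *\<^sub>R 1) * y = 1" "norm y \<le> 1 / e" "bicommutes p y"
    "self_adjoint y"
proof -
  define t where "t = norm p + e"
  have t: "0 < t" "e \<le> t" using e norm_ge_zero[of p] unfolding t_def by linarith+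
  define s where "s = p + e *\<^sub>R 1"
  define q where "q = (1/t) *\<^sub>R (norm p *\<^sub>R 1 - p)"
  have s: "s = t *\<^sub>R (1 - q)" using t by (simp add: q_def s_def t_def scaleR_diff_right scaleR_left_distrib)
  have "norm (norm p *\<^sub>R 1 - p) \<le> norm p" by (rule nonneg_norm_bound[OF p]) simp
  then have q: "norm q \<le> norm p / t" using t by (simp add: q_def divide_right_mono)
  have pt: "norm p / t < 1" using e t by (simp add: t_def)
  have one_le: "norm (1::'a) \<le> 1" by (rule norm_one_le)
  have c: "0 \<le> norm p / t" using t by simp
  have "\<exists>!y. (1/t) *\<^sub>R 1 + q * y = y"
  proof (rule banach_fix_type[OF c pt], intro allI)
    fix x y :: 'a
    have "norm (q * (x - y)) \<le> norm q * norm (x - y)" by (rule norm_mult_ineq)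
    also have "\<dots> \<le> norm p / t * norm (x - y)" using q by (rule mult_right_mono) simp
    finally show "dist ((1/t) *\<^sub>R 1 + q * x) ((1/t) *\<^sub>R 1 + q * y) \<le> norm p / t * dist x y"
      by (simp add: dist_norm right_diff_distrib)
  qed
  then obtain y where y: "y = (1/t) *\<^sub>R 1 + q * y" by metis
  have "\<exists>!y. (1/t) *\<^sub>R 1 + y * q = y"
  proof (rule banach_fix_type[OF c pt], intro allI)
    fix x y :: 'a
    have "norm ((x - y) * q) \<le> norm (x - y) * norm q" by (rule norm_mult_ineq)
    also have "\<dots> \<le> norm (x - y) * (norm p / t)" using q by (rule mult_left_mono) simp
    finally show "dist ((1/t) *\<^sub>R 1 + x * q) ((1/t) *\<^sub>R 1 + y * q) \<le> norm p / t * dist x y"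
      by (simp add: dist_norm left_diff_distrib mult.commute)
  qed
  then obtain y' where y': "y' = (1/t) *\<^sub>R 1 + y' * q" by metis
  have sy: "s * y = 1"
  proof -
    have "t *\<^sub>R y = 1 + t *\<^sub>R (q * y)" using t by (subst y) (simp add: scaleR_add_right)
    then show ?thesis by (simp add: s algebra_simps)
  qed
  have ys': "y' * s = 1"
  proof -
    have "t *\<^sub>R y' = 1 + t *\<^sub>R (y' * q)" using t by (subst y') (simp add: scaleR_add_right)
    then show ?thesis by (simp add: s algebra_simps)
  qed
  have "y' = y' * (s * y)" by (simp add: sy)
  also have "\<dots> = y" by (simp only: mult.assoc[symmetric] ys') simp
  finally have ys: "y * s = 1" using ys' by simp
  have "norm y \<le> 1 / t + norm p / t * norm y"
  proof -
    have "norm y \<le> norm ((1/t) *\<^sub>R (1::'a)) + norm (q * y)"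
      by (subst y) (rule norm_triangle_ineq)
    also have "\<dots> \<le> 1 / t + norm p / t * norm y"
      using t norm_scaleR_one_le[of "1/t", where 'a='a]
        order_trans[OF norm_mult_ineq mult_right_mono[OF q norm_ge_zero], of y]
      by (intro add_mono) auto
    finally show ?thesis .
  qed
  then have "norm y * t \<le> 1 + norm p * norm y" using t by (simp add: field_simps)
  then have ny: "norm y \<le> 1 / e" using e by (simp add: t_def field_simps)
  have "bicommutes p y"
    unfolding bicommutes_def
  proof (intro allI impI)
    fix z assume "z * p = p * z"
    then have zs: "z * s = s * z" by (simp add: s_def algebra_simps)
    have "z * y = y * s * (z * y)" by (simp add: ys)
    also have "\<dots> = y * (s * z) * y" by (simp add: mult.assoc)
    also have "\<dots> = y * z * (s * y)" by (simp add: zs[symmetric] mult.assoc)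
    finally show "z * y = y * z" by (simp add: sy)
  qed
  moreover have "self_adjoint y"
  proof -
    have ss: "star s = s"
      using nonneg_self_adjoint[OF p] by (simp add: s_def star_add star_scaleR self_adjoint_def)
    have "star y * s = 1" using arg_cong[OF sy, of star] by (simp add: star_mult ss)
    then have "star y * (s * y) = y" by (simp add: mult.assoc[symmetric])
    then show ?thesis by (simp add: sy self_adjoint_def)
  qed
  ultimately show ?thesis using that ys sy ny by (simp add: s_def)
qed

section \<open>Locality implies commutation\<close>

text \<open>One orthogonality removes the mixed terms of \<open>star S * S\<close>, the other makes
  the \<open>p i\<close> annihilate each other. So \<open>(star S * S) ^ n\<close> is the sum of the
  \<open>p i ^ n\<close>, and the factor \<open>card I\<close> in its bound does not affect the
  growth rate.\<close>

lemma norm_sum_orthogonal: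
  fixes c :: "nat \<Rightarrow> 'a::cstar_algebra_1"
  assumes I: "finite I" and K: "0 \<le> K" "\<And>i. i \<in> I \<Longrightarrow> norm (c i) \<le> K"
    and orth: "\<And>i j. i \<in> I \<Longrightarrow> j \<in> I \<Longrightarrow> i \<noteq> j \<Longrightarrow> star (c i) * c j = 0"
      "\<And>i j. i \<in> I \<Longrightarrow> j \<in> I \<Longrightarrow> i \<noteq> j \<Longrightarrow> c i * star (c j) = 0"
  shows "norm (\<Sum>i\<in>I. c i) \<le> K"
proof -
  define S where "S = (\<Sum>i\<in>I. c i)"
  define p where "p i = star (c i) * c i" for i
  have star_sum: "star (\<Sum>i\<in>J. c i) = (\<Sum>i\<in>J. star (c i))" if "finite J" for J
    using that by (induction J) (auto simp: star_add)
  have "star S * S = (\<Sum>i\<in>I. \<Sum>j\<in>I. star (c i) * c j)"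
    by (simp add: S_def star_sum[OF I] sum_product)
  also have "\<dots> = (\<Sum>i\<in>I. \<Sum>j\<in>I. if j = i then p i else 0)"
    using orth by (intro sum.cong) (auto simp: p_def)
  also have "\<dots> = (\<Sum>i\<in>I. p i)" using I by simp
  finally have SS: "star S * S = (\<Sum>i\<in>I. p i)" .
  have pp: "p i * p j = 0" if "i \<in> I" "j \<in> I" "i \<noteq> j" for i j
    using orth(2)[OF that] unfolding p_def by (metis mult.assoc mult_zero_left mult_zero_right)
  have pow: "(star S * S) ^ n = (\<Sum>i\<in>I. p i ^ n)" if "0 < n" for n
    using that
  proof (induction n)
    case (Suc n)
    show ?case
    proof (cases "n = 0")
      case False
      have "(star S * S) ^ Suc n = (\<Sum>i\<in>I. \<Sum>j\<in>I. p i * p j ^ n)"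
        using Suc False by (simp add: SS sum_product)
      also have "\<dots> = (\<Sum>i\<in>I. \<Sum>j\<in>I. if j = i then p i ^ Suc n else 0)"
      proof (intro sum.cong refl)
        fix i j assume "i \<in> I" "j \<in> I"
        then show "p i * p j ^ n = (if j = i then p i ^ Suc n else 0)"
          using pp[of i j] False by (cases n) (auto simp: mult.assoc[symmetric])
      qed
      finally show ?thesis using I by simp
    qed (simp add: SS)
  qed simp
  have "norm ((star S * S) ^ n) \<le> real (card I) * real (n + 1) * (K\<^sup>2) ^ n" if n: "0 < n" for n
  proof -
    have "norm (p i ^ n) \<le> (K\<^sup>2) ^ n" if "i \<in> I" for i
    proof -
      have "norm (p i) \<le> K\<^sup>2" using K that by (simp add: p_def norm_star_mult_self)
      then show ?thesis using norm_power_le[OF n, of "p i"] by (meson norm_ge_zero order_trans power_mono)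
    qed
    then have "norm ((star S * S) ^ n) \<le> real (card I) * (K\<^sup>2) ^ n"
      unfolding pow[OF n] by (rule sum_norm_bound)
    also have "\<dots> \<le> real (card I) * real (n + 1) * (K\<^sup>2) ^ n"
      using K by (intro mult_right_mono) (auto simp: mult_le_cancel_left1)
    finally show ?thesis .
  qed
  then have "norm (star S * S) \<le> K\<^sup>2"
    using K by (intro norm_le_of_power_bound[OF self_adjoint_star_mult]) auto
  then have "(norm S)\<^sup>2 \<le> K\<^sup>2" by (simp add: norm_star_mult_self)
  then have "norm S \<le> K" using K(1) by (rule power2_le_imp_le)
  then show ?thesis by (simp add: S_def)
qed

text \<open>Here \<open>v i = (f i - 1)\<^sup>-\<close> and \<open>f i = (H - i)\<^sup>+\<close>; the elements \<open>1 - v i\<close> slice \<open>H\<close> into layers of height \<open>1\<close>.\<close>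

lemma layers:
  fixes H :: "'a::cstar_algebra_1"
  assumes H: "nonneg H"
  obtains v :: "nat \<Rightarrow> 'a" and N
  where "\<And>i. nonneg (v i)" "\<And>i. norm (v i) \<le> 1" "\<And>i. bicommutes H (v i)"
    "\<And>i. v i * v (Suc i) = v i" "H = (\<Sum>i<N. 1 - v i)"
proof -
  have "\<exists>w. nonneg (fst w) \<and> nonneg (snd w) \<and> bicommutes f (fst w) \<and> bicommutes f (snd w) \<and>
      f - 1 = fst w - snd w \<and> fst w * snd w = 0 \<and> norm (snd w) \<le> 1 \<and> norm (fst w) \<le> max 0 (norm f - 1)"
    if f: "nonneg f" for f :: 'a
  proof -
    obtain u v where "nonneg u" "nonneg v" "bicommutes f u" "bicommutes f v"
      "f - 1 *\<^sub>R 1 = u - v" "u * v = 0" "norm v \<le> 1" "norm u \<le> max 0 (norm f - 1)"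
      using truncation[OF f zero_le_one] by blast
    then show ?thesis by (intro exI[of _ "(u, v)"]) simp
  qed
  then obtain W :: "'a \<Rightarrow> 'a \<times> 'a" where W: "\<And>f. nonneg f \<Longrightarrow> nonneg (fst (W f)) \<and> nonneg (snd (W f)) \<and>
      bicommutes f (fst (W f)) \<and> bicommutes f (snd (W f)) \<and> f - 1 = fst (W f) - snd (W f) \<and>
      fst (W f) * snd (W f) = 0 \<and> norm (snd (W f)) \<le> 1 \<and> norm (fst (W f)) \<le> max 0 (norm f - 1)"
    by metis
  define U where "U f = fst (W f)" for f
  define V where "V f = snd (W f)" for f
  have UV: "nonneg (U f)" "nonneg (V f)" "bicommutes f (U f)" "bicommutes f (V f)"
    "f - 1 = U f - V f" "U f * V f = 0" "norm (V f) \<le> 1" "norm (U f) \<le> max 0 (norm f - 1)"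
    if "nonneg f" for f
    using W[OF that] by (simp_all add: U_def V_def)
  define f where "f i = (U ^^ i) H" for i
  define v where "v i = V (f i)" for i
  have fS: "f (Suc i) = U (f i)" for i by (simp add: f_def)
  have f: "nonneg (f i) \<and> bicommutes H (f i)" for i
    by (induction i) (auto simp: f_def H UV bicommutes_refl intro: bicommutes_trans)
  have v: "nonneg (v i)" "norm (v i) \<le> 1" "bicommutes H (v i)" for i
    using f[of i] UV by (auto simp: v_def intro: bicommutes_trans)
  have rel: "f i - 1 = f (Suc i) - v i" for i using f UV by (simp add: v_def fS)
  have fv: "f (Suc i) * v i = 0" for i using f UV by (simp add: v_def fS)
  have comm: "v i * v j = v j * v i" "v i * f j = f j * v i" for i j
    using bicommutes_commute v f by blast+
  \<comment> \<open>\<open>f (i+1)\<close> annihilates \<open>v i\<close> and equals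
    \<open>1 + f (i+2) - v (i+1)\<close>. The claim thus amounts to \<open>?e = 0\<close>, which
    holds because \<open>?e\<close> and \<open>?e * f (i+2)\<close> are nonnegative with sum
    0.\<close>
  have vv: "v i * v (Suc i) = v i" for i
  proof -
    let ?e = "v i * f (Suc (Suc i))"
    have fe: "f (Suc i) = 1 + f (Suc (Suc i)) - v (Suc i)" using rel[of "Suc i"] by (simp add: algebra_simps)
    have e: "nonneg ?e" using comm f v by (intro nonneg_mult) auto
    have "(v i * f (Suc i)) * f (Suc (Suc i)) = 0" using fv comm(2) by simp
    moreover have "v (Suc i) * f (Suc (Suc i)) = 0" using fv comm(2) by simp
    ultimately have "?e + ?e * f (Suc (Suc i)) = 0"
      by (simp add: fe algebra_simps)
    moreover have "nonneg (?e * f (Suc (Suc i)))"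
      using f e bicommutes_commute[OF bicommutes_mult[of H "v i" "f (Suc (Suc i))"], of "f (Suc (Suc i))"] v
      by (intro nonneg_mult[OF e]) auto
    ultimately have "?e = 0" using nonneg_add_eq_0 e by blast
    moreover have "v i * f (Suc i) = 0" using fv comm(2) by simp
    ultimately show ?thesis by (simp add: fe algebra_simps)
  qed
  have fnorm: "norm (f i) \<le> max 0 (norm H - real i)" for i
  proof (induction i)
    case (Suc i)
    have "norm (f (Suc i)) \<le> max 0 (norm (f i) - 1)" using UV f by (simp add: fS)
    with Suc show ?case by (auto simp: max_def split: if_splits)
  qed (simp add: f_def)
  \<comment> \<open>Each truncation lowers the norm by 1 until it is 0, so \<open>f N = 0\<close>;
    the layers \<open>1 - v i = f i - f (i+1)\<close> telescope.\<close>
  obtain N where N: "norm H \<le> real N" using real_arch_simple by blast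
  then have "f N = 0" using fnorm[of N] by (simp add: max_def split: if_splits)
  moreover have "(\<Sum>i<n. 1 - v i) = H - f n" for n
  proof (induction n)
    case (Suc n)
    have "(\<Sum>i<Suc n. 1 - v i) = H - (f n - 1) - v n" using Suc by simp
    then show ?case by (simp add: rel)
  qed (simp add: f_def)
  ultimately show ?thesis using that v vv by (metis diff_zero)
qed

text \<open>
  The commutator of \<open>m\<close> with each layer of \<open>nh\<close> is supported near that layer.  Hence the
  commutators with every other layer are mutually orthogonal, and their sum has norm at most
  \<open>2\<parallel>m\<parallel>\<close>.  This bounds \<open>\<parallel>[nh, m]\<parallel>\<close> independently of \<open>n\<close>.
\<close>

theorem local_imp_commute:
  fixes h m :: "'a::cstar_algebra_1"
  assumes h: "nonneg h"
    and local: "\<And>a b. self_adjoint a \<Longrightarrow> self_adjoint b \<Longrightarrow> bicommutes h a \<Longrightarrow> bicommutes h b \<Longrightarrow>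
      a * b = 0 \<Longrightarrow> a * m * b = 0"
  shows "h * m = m * h"
proof -
  have bound: "norm (real n *\<^sub>R (h * m - m * h)) \<le> 4 * norm m" for n
  proof -
    let ?H = "real n *\<^sub>R h"
    have bh: "bicommutes h ?H" by (intro bicommutes_intros)
    obtain v :: "nat \<Rightarrow> 'a" and N
      where v: "\<And>i. nonneg (v i)" "\<And>i. norm (v i) \<le> 1" "\<And>i. bicommutes ?H (v i)"
        "\<And>i. v i * v (Suc i) = v i" and H: "?H = (\<Sum>i<N. 1 - v i)"
      using layers[OF nonneg_scaleR[OF h, of "real n"]] by (metis of_nat_0_le_iff)
    have vh: "bicommutes h (v i)" for i using v(3) bh bicommutes_trans by blast
    have sa: "self_adjoint (v i)" for i using v nonneg_self_adjoint by blast
    have comm: "v i * v j = v j * v i" for i j using bicommutes_commute vh by blast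
    have vv: "v i * v j = v i" if "i < j" for i j
      using that
    proof (induction j)
      case (Suc j)
      show ?case
      proof (cases "i = j")
        case False
        then have "v i * v j = v i" using Suc by simp
        then show ?thesis using v(4)[of j] by (metis mult.assoc)
      qed (simp add: v)
    qed simp
    \<comment> \<open>\<open>1 - v j\<close> annihilates \<open>v i\<close>, so locality applies to
      this pair.\<close>
    have m: "v i * m * v j = v i * m" "v j * m * v i = m * v i" if "i < j" for i j
    proof -
      have "v i * (1 - v j) = 0" using vv[OF that] by (simp add: algebra_simps)
      moreover have "(1 - v j) * v i = 0" using vv[OF that] comm[of i j] by (simp add: algebra_simps)
      ultimately have "v i * m * (1 - v j) = 0" "(1 - v j) * m * v i = 0"
        by (auto intro!: local sa vh self_adjoint_diff self_adjoint_one bicommutes_diff bicommutes_one)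
      then show "v i * m * v j = v i * m" "v j * m * v i = m * v i"
        by (simp_all add: left_diff_distrib right_diff_distrib)
    qed
    \<comment> \<open>The commutator of the layer \<open>1 - v i\<close> with
      \<open>m\<close>.\<close>
    define c where "c i = m * v i - v i * m" for i
    have vv': "v j * v i = v i" if "i < j" for i j
      using vv[OF that] comm by simp
    have cv: "c i * v j = c i" "v j * c i = c i" if "i < j" for i j
    proof -
      have "c i * v j = m * (v i * v j) - v i * m * v j"
        "v j * c i = v j * m * v i - (v j * v i) * m"
        by (simp_all add: c_def left_diff_distrib right_diff_distrib mult.assoc)
      then show "c i * v j = c i" "v j * c i = c i" using m[OF that] vv[OF that] vv'[OF that] by (simp_all add: c_def)
    qed
    have cv0: "c j * v i = 0" "v i * c j = 0" if "i < j" for i j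
    proof -
      have "c j * v i = m * (v j * v i) - v j * m * v i"
        "v i * c j = v i * m * v j - (v i * v j) * m"
        by (simp_all add: c_def left_diff_distrib right_diff_distrib mult.assoc)
      then show "c j * v i = 0" "v i * c j = 0" using m[OF that] vv[OF that] vv'[OF that] by simp_all
    qed
    \<comment> \<open>\<open>v (i+1)\<close> fixes \<open>c i\<close> and annihilates
      \<open>c j\<close>. This takes an index strictly between \<open>i\<close> and
      \<open>j\<close>, which is why the layers are split by parity.\<close>
    have far: "c i * star (c j) = 0 \<and> star (c i) * c j = 0" if "Suc i < j" for i j
    proof
      have sv: "star (v (Suc i)) = v (Suc i)" using sa by (simp add: self_adjoint_def)
      have "c i * star (c j) = c i * star (c j * v (Suc i))"
        by (simp add: star_mult sv mult.assoc[symmetric] cv)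
      then show "c i * star (c j) = 0" using cv0(1)[OF that] by simp
      have "star (c i) * c j = star (v (Suc i) * c i) * c j" by (simp add: cv)
      also have "\<dots> = star (c i) * (v (Suc i) * c j)" by (simp add: star_mult sv mult.assoc)
      finally show "star (c i) * c j = 0" using cv0(2)[OF that] by simp
    qed
    have far': "c i * star (c j) = 0 \<and> star (c i) * c j = 0" if "Suc i < j \<or> Suc j < i" for i j
      using that far[of i j] far[of j i] by (metis star_mult star_star star_zero)
    have nc: "norm (c i) \<le> 2 * norm m" for i
    proof -
      have "norm (c i) \<le> norm m * norm (v i) + norm (v i) * norm m"
        unfolding c_def using norm_triangle_ineq4[of "m * v i" "v i * m"]
          norm_mult_ineq[of m "v i"] norm_mult_ineq[of "v i" m] by linarith
      moreover have "norm m * norm (v i) \<le> norm m" by (rule mult_left_le[OF v(2) norm_ge_zero])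
      ultimately show ?thesis by (simp add: mult.commute)
    qed
    have half: "norm (\<Sum>i\<in>{i. i < N \<and> P i}. c i) \<le> 2 * norm m"
      if P: "\<And>i j. P i \<Longrightarrow> P j \<Longrightarrow> i < j \<Longrightarrow> Suc i < j" for P
    proof (rule norm_sum_orthogonal[OF _ _ nc])
      fix i j assume "i \<in> {i. i < N \<and> P i}" "j \<in> {i. i < N \<and> P i}" "i \<noteq> j"
      then have "Suc i < j \<or> Suc j < i" using P[of i j] P[of j i] by (auto simp: neq_iff)
      then show "star (c i) * c j = 0" "c i * star (c j) = 0" using far' by blast+
    qed auto
    have "real n *\<^sub>R (h * m - m * h) = ?H * m - m * ?H" by (simp add: scaleR_diff_right)
    also have "\<dots> = (\<Sum>i<N. c i)"
      unfolding H c_def sum_distrib_left sum_distrib_right sum_subtractf[symmetric]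
      by (simp add: algebra_simps)
    also have "\<dots> = (\<Sum>i\<in>{i. i < N \<and> even i}. c i) + (\<Sum>i\<in>{i. i < N \<and> odd i}. c i)"
      by (subst sum.union_disjoint[symmetric]) (auto intro!: sum.cong)
    finally have "norm (real n *\<^sub>R (h * m - m * h)) \<le>
        norm (\<Sum>i\<in>{i. i < N \<and> even i}. c i) + norm (\<Sum>i\<in>{i. i < N \<and> odd i}. c i)"
      by (simp only: norm_triangle_ineq)
    also have "\<dots> \<le> 2 * norm m + 2 * norm m"
      by (intro add_mono half) (metis Suc_lessI even_Suc)+
    finally show ?thesis by simp
  qed
  have "norm (h * m - m * h) \<le> 0"
  proof (rule ccontr)
    assume "\<not> ?thesis"
    then have pos: "0 < norm (h * m - m * h)" by simp
    obtain n where "4 * norm m / norm (h * m - m * h) < real n" using reals_Archimedean2 by blast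
    with pos have "4 * norm m < norm (real n *\<^sub>R (h * m - m * h))" by (simp add: pos_divide_less_eq)
    with bound[of n] show False by simp
  qed
  then show ?thesis by simp
qed

section \<open>The multiplier algebra as a C*-algebra\<close>

lemma double_centralizerD:
  assumes "double_centralizer L R"
  shows "bounded_linear L" "bounded_linear R" "L (c *\<^sub>C a) = c *\<^sub>C L a" "R (c *\<^sub>C a) = c *\<^sub>C R a"
    "L (a * b) = L a * b" "R (a * b) = a * R b" "R a * b = a * L b"
  using assms by (auto simp: double_centralizer_def bounded_clinear_def)

lemmas mul_simps = double_centralizerD(3-7)[OF double_centralizer_mul]

lemma bounded_linear_lmul: "bounded_linear (lmul d)"
  and bounded_linear_rmul: "bounded_linear (rmul d)"
  using double_centralizerD(1,2)[OF double_centralizer_mul] .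

lemma mul_diff: "lmul (d - e) = (\<lambda>a. lmul d a - lmul e a)" "rmul (d - e) = (\<lambda>a. rmul d a - rmul e a)"
  unfolding minus_multiplier_def mul_plus mul_uminus by simp_all

text \<open>The left part determines the right one: \<open>(rmul d a - rmul e a) * b = 0\<close> for
  all \<open>b\<close>, in particular for the adjoint of the first factor.\<close>

lemma mul_ext:
  assumes "\<And>a. lmul d a = lmul e a"
  shows "d = e"
proof (rule multiplier_eqI)
  show "lmul d = lmul e" using assms by auto
  show "rmul d = rmul e"
  proof
    fix a
    have "(rmul d a - rmul e a) * b = 0" for b by (simp add: left_diff_distrib mul_simps assms)
    from this[of "star (rmul d a - rmul e a)"] show "rmul d a = rmul e a" by simp
  qed
qed

lemma bounded_linear_scaleC: "bounded_linear (\<lambda>a::'a::cstar_algebra. c *\<^sub>C a)"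
proof (rule bounded_linear_intro[of _ "cmod c"])
  fix r and a :: 'a
  show "c *\<^sub>C (r *\<^sub>R a) = r *\<^sub>R (c *\<^sub>C a)"
    unfolding scaleC_of_real[symmetric] scaleC_scaleC by (simp only: mult.commute)
qed (simp_all add: scaleC_add_right norm_scaleC)

lemma bounded_linear_star: "bounded_linear (star :: 'a::cstar_algebra \<Rightarrow> 'a)"
  by (rule bounded_linear_intro[of _ 1]) (auto simp: star_add star_scaleR norm_star)

lemma double_centralizer_scaleC:
  assumes "double_centralizer L R"
  shows "double_centralizer (\<lambda>a. c *\<^sub>C L a) (\<lambda>a. c *\<^sub>C R a)"
proof -
  note d = double_centralizerD[OF assms]
  have "c *\<^sub>C (c' *\<^sub>C a) = c' *\<^sub>C (c *\<^sub>C a)" for c' and a :: 'a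
    unfolding scaleC_scaleC by (simp only: mult.commute)
  then show ?thesis
    using bounded_linear_compose[OF bounded_linear_scaleC d(1)]
      bounded_linear_compose[OF bounded_linear_scaleC d(2)]
    by (simp add: double_centralizer_def bounded_clinear_def mult_scaleC_left mult_scaleC_right d)
qed

lemma double_centralizer_star:
  assumes "double_centralizer L R"
  shows "double_centralizer (\<lambda>a. star (R (star a))) (\<lambda>a. star (L (star a)))"
proof -
  note d = double_centralizerD[OF assms]
  have "bounded_linear (\<lambda>a. star (f (star a)))" if "bounded_linear f" for f :: "'a \<Rightarrow> 'a"
    using bounded_linear_compose[OF bounded_linear_star bounded_linear_compose[OF that bounded_linear_star]] .
  then show ?thesis
    unfolding double_centralizer_def bounded_clinear_def
    using d by (simp add: star_mult star_scaleC star_star) (metis star_mult star_star)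
qed

lemma double_centralizer_scaleR:
  "double_centralizer L R \<Longrightarrow> double_centralizer (\<lambda>a. r *\<^sub>R L a) (\<lambda>a. r *\<^sub>R R a)"
  using double_centralizer_scaleC[of L R "complex_of_real r"] by (simp add: scaleC_of_real)

section \<open>The norm of multipliers and its completeness\<close>

instantiation multiplier :: (cstar_algebra) real_normed_algebra
begin

definition "norm (d :: 'a multiplier) = onorm (lmul d)"
definition "r *\<^sub>R d = Abs_multiplier (\<lambda>a::'a. r *\<^sub>R lmul d a, \<lambda>a. r *\<^sub>R rmul d a)"
definition "sgn (d :: 'a multiplier) = inverse (norm d) *\<^sub>R d"
definition "dist (d :: 'a multiplier) e = norm (d - e)"
definition "(uniformity :: ('a multiplier \<times> 'a multiplier) filter) =
  (INF e\<in>{0 <..}. principal {(x, y). dist x y < e})"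
definition "open (U :: 'a multiplier set) \<longleftrightarrow>
  (\<forall>x\<in>U. eventually (\<lambda>(x', y). x' = x \<longrightarrow> y \<in> U) uniformity)"

lemma mul_scaleR: "lmul (r *\<^sub>R d) = (\<lambda>a::'a. r *\<^sub>R lmul d a)" "rmul (r *\<^sub>R d) = (\<lambda>a::'a. r *\<^sub>R rmul d a)"
  unfolding scaleR_multiplier_def
  by (simp_all add: mul_Abs[OF double_centralizer_scaleR[OF double_centralizer_mul]])

lemma norm_lmul_le: "norm (lmul d a) \<le> norm d * norm (a::'a)"
  unfolding norm_multiplier_def by (rule onorm[OF bounded_linear_lmul])

lemma norm_multiplier_nonneg: "0 \<le> norm (d :: 'a multiplier)"
  unfolding norm_multiplier_def by (rule onorm_pos_le[OF bounded_linear_lmul])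

lemma norm_multiplier_le: "0 \<le> r \<Longrightarrow> (\<And>a::'a. norm (lmul d a) \<le> r * norm a) \<Longrightarrow> norm d \<le> r"
  unfolding norm_multiplier_def by (rule onorm_bound)

text \<open>The norm is defined through \<open>lmul\<close> alone. The relation
  \<open>R a * b = a * L b\<close> at \<open>b = star (R a)\<close> transfers the bound to
  \<open>rmul\<close>; completeness needs it, as both parts of a Cauchy sequence must
  converge.\<close>

lemma norm_rmul_le: "norm (rmul d a) \<le> norm d * norm (a::'a)"
proof (cases "rmul d a = 0")
  case False
  let ?r = "rmul d a"
  have "norm ?r * norm ?r = norm (a * lmul d (star ?r))"
    using norm_mult_star_self[of ?r] by (simp add: mul_simps power2_eq_square)
  also have "\<dots> \<le> norm a * norm (lmul d (star ?r))" by (rule norm_mult_ineq)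
  also have "\<dots> \<le> norm a * (norm d * norm ?r)"
    using norm_lmul_le[of d "star ?r"] by (intro mult_left_mono) (simp_all add: norm_star)
  finally show ?thesis using False by (simp add: mult.commute mult.left_commute)
qed (simp add: norm_multiplier_nonneg)

instance
proof
  fix a b :: "'a multiplier" and r s :: real
  show "r *\<^sub>R (a + b) = r *\<^sub>R a + r *\<^sub>R b" "(r + s) *\<^sub>R a = r *\<^sub>R a + s *\<^sub>R a"
    "r *\<^sub>R s *\<^sub>R a = (r * s) *\<^sub>R a" "1 *\<^sub>R a = a" "r *\<^sub>R a * b = r *\<^sub>R (a * b)"
    by (rule mul_ext, simp add: mul_scaleR mul_plus mul_times scaleR_add_right scaleR_add_left)+
  show "a * r *\<^sub>R b = r *\<^sub>R (a * b)"
    by (rule mul_ext)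
      (simp add: mul_scaleR mul_times linear_scale[OF bounded_linear.linear[OF bounded_linear_lmul]])
  show "sgn a = inverse (norm a) *\<^sub>R a" by (rule sgn_multiplier_def)
  show "dist a b = norm (a - b)" by (rule dist_multiplier_def)
  show "uniformity = (INF e\<in>{0<..}. principal {(x, y). dist (x :: 'a multiplier) y < e})"
    by (rule uniformity_multiplier_def)
  show "open U = (\<forall>x\<in>U. \<forall>\<^sub>F (x', y) in uniformity. x' = x \<longrightarrow> y \<in> U)" for U :: "'a multiplier set"
    by (rule open_multiplier_def)
  show "norm a = 0 \<longleftrightarrow> a = 0"
  proof
    assume "norm a = 0"
    then show "a = 0" using norm_lmul_le[of a] by (intro mul_ext) (simp add: mul_zero)
  next
    assume "a = 0"
    then have "norm a \<le> 0" by (intro norm_multiplier_le) (simp_all add: mul_zero)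
    then show "norm a = 0" using norm_multiplier_nonneg[of a] by simp
  qed
  show "norm (a + b) \<le> norm a + norm b"
  proof (rule norm_multiplier_le[rotated])
    fix x
    show "norm (lmul (a + b) x) \<le> (norm a + norm b) * norm x"
      using norm_lmul_le[of a x] norm_lmul_le[of b x] norm_triangle_ineq[of "lmul a x" "lmul b x"]
      by (simp add: mul_plus algebra_simps)
  qed (simp add: norm_multiplier_nonneg)
  have le: "norm (r *\<^sub>R a) \<le> \<bar>r\<bar> * norm a" for r and a :: "'a multiplier"
    using norm_lmul_le[of a]
    by (intro norm_multiplier_le) (simp_all add: mul_scaleR mult.assoc mult_left_mono norm_multiplier_nonneg)
  show "norm (r *\<^sub>R a) = \<bar>r\<bar> * norm a"
  proof (cases "r = 0")
    case True
    then show ?thesis using le[of r a] norm_multiplier_nonneg[of "r *\<^sub>R a"] by simp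
  next
    case False
    have "inverse r *\<^sub>R (r *\<^sub>R a) = a"
      using False by (intro mul_ext) (simp add: mul_scaleR)
    then have "norm a \<le> \<bar>inverse r\<bar> * norm (r *\<^sub>R a)" using le[of "inverse r" "r *\<^sub>R a"] by simp
    then have "\<bar>r\<bar> * norm a \<le> norm (r *\<^sub>R a)" using False by (simp add: field_simps)
    with le[of r a] show ?thesis by simp
  qed
  show "norm (a * b) \<le> norm a * norm b"
  proof (rule norm_multiplier_le[rotated])
    fix x
    have "norm (lmul a (lmul b x)) \<le> norm a * norm (lmul b x)" by (rule norm_lmul_le)
    also have "\<dots> \<le> norm a * (norm b * norm x)"
      by (intro mult_left_mono norm_lmul_le norm_multiplier_nonneg)
    finally show "norm (lmul (a * b) x) \<le> norm a * norm b * norm x" by (simp add: mul_times mult.assoc)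
  qed (simp add: norm_multiplier_nonneg)
qed

end

lemma multiplier_Cauchy_convergent:
  fixes d :: "nat \<Rightarrow> 'a::cstar_algebra multiplier"
  assumes cauchy: "Cauchy d"
  shows "convergent d"
proof -
  define L where "L n = Blinfun (lmul (d n))" for n
  define R where "R n = Blinfun (rmul (d n))" for n
  have LR: "blinfun_apply (L n) = lmul (d n)" "blinfun_apply (R n) = rmul (d n)" for n
    by (simp_all add: L_def R_def bounded_linear_Blinfun_apply bounded_linear_lmul bounded_linear_rmul)
  have le: "norm (L m - L n) \<le> norm (d m - d n)" "norm (R m - R n) \<le> norm (d m - d n)" for m n
    using norm_lmul_le[of "d m - d n"] norm_rmul_le[of "d m - d n"] norm_multiplier_nonneg[of "d m - d n"]
    by (auto intro!: norm_blinfun_bound simp: blinfun.diff_left LR mul_diff)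
  have "Cauchy L" "Cauchy R"
    using cauchy le unfolding Cauchy_def dist_norm by (meson le_less_trans)+
  then obtain l r where l: "L \<longlonglongrightarrow> l" and r: "R \<longlonglongrightarrow> r"
    using Cauchy_convergent_iff convergent_def by metis
  have la: "(\<lambda>n. lmul (d n) a) \<longlonglongrightarrow> blinfun_apply l a" for a
    using tendsto_intros(1) blinfun.tendsto[OF l tendsto_const[of a]] by (simp add: LR)
  have ra: "(\<lambda>n. rmul (d n) a) \<longlonglongrightarrow> blinfun_apply r a" for a
    using blinfun.tendsto[OF r tendsto_const[of a]] by (simp add: LR)
  have dc: "double_centralizer (blinfun_apply l) (blinfun_apply r)"
    unfolding double_centralizer_def bounded_clinear_def
  proof (intro conjI allI)
    fix a b :: 'a and c :: complex
    show "blinfun_apply l (c *\<^sub>C a) = c *\<^sub>C blinfun_apply l a"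
      using LIMSEQ_unique[OF la[of "c *\<^sub>C a"]] bounded_linear.tendsto[OF bounded_linear_scaleC la[of a], of c]
      by (simp add: mul_simps)
    show "blinfun_apply r (c *\<^sub>C a) = c *\<^sub>C blinfun_apply r a"
      using LIMSEQ_unique[OF ra[of "c *\<^sub>C a"]] bounded_linear.tendsto[OF bounded_linear_scaleC ra[of a], of c]
      by (simp add: mul_simps)
    show "blinfun_apply l (a * b) = blinfun_apply l a * b"
      using LIMSEQ_unique[OF la[of "a * b"]] tendsto_mult[OF la[of a] tendsto_const[of b]]
      by (simp add: mul_simps)
    show "blinfun_apply r (a * b) = a * blinfun_apply r b"
      using LIMSEQ_unique[OF ra[of "a * b"]] tendsto_mult[OF tendsto_const[of a] ra[of b]]
      by (simp add: mul_simps)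
    show "blinfun_apply r a * b = a * blinfun_apply l b"
      using LIMSEQ_unique[OF tendsto_mult[OF ra[of a] tendsto_const[of b]]] tendsto_mult[OF tendsto_const[of a] la[of b]]
      by (simp add: mul_simps)
  qed (rule blinfun.bounded_linear_right)+
  define e where "e = Abs_multiplier (blinfun_apply l, blinfun_apply r)"
  have "norm (d n - e) \<le> norm (L n - l)" for n
  proof (rule norm_multiplier_le[rotated])
    fix a
    have "lmul (d n - e) a = blinfun_apply (L n - l) a"
      by (simp add: e_def mul_diff mul_Abs[OF dc] blinfun.diff_left LR)
    then show "norm (lmul (d n - e) a) \<le> norm (L n - l) * norm a" by (simp add: norm_blinfun)
  qed simp
  then have "(\<lambda>n. norm (d n - e)) \<longlonglongrightarrow> 0"
    using l norm_multiplier_nonneg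
    by (intro tendsto_sandwich[OF _ _ tendsto_const[of 0] LIM_zero[OF l, THEN tendsto_norm_zero]])
      (auto intro!: always_eventually)
  then have "(\<lambda>n. d n - e) \<longlonglongrightarrow> 0" by (rule tendsto_norm_zero_cancel)
  then have "d \<longlonglongrightarrow> e" by (rule LIM_zero_cancel)
  then show ?thesis by (rule convergentI)
qed

instance multiplier :: (cstar_algebra) banach
  by standard (rule multiplier_Cauchy_convergent)

section \<open>Involution and C*-identity for multipliers\<close>

instantiation multiplier :: (cstar_algebra) cstar_algebra
begin

definition "c *\<^sub>C d = Abs_multiplier (\<lambda>a::'a. c *\<^sub>C lmul d a, \<lambda>a. c *\<^sub>C rmul d a)"
definition "star d = Abs_multiplier (\<lambda>a::'a. star (rmul d (star a)), \<lambda>a. star (lmul d (star a)))"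

lemma mul_scaleC: "lmul (c *\<^sub>C d) = (\<lambda>a::'a. c *\<^sub>C lmul d a)" "rmul (c *\<^sub>C d) = (\<lambda>a::'a. c *\<^sub>C rmul d a)"
  unfolding scaleC_multiplier_def
  by (simp_all add: mul_Abs[OF double_centralizer_scaleC[OF double_centralizer_mul]])

lemma mul_star: "lmul (star d) = (\<lambda>a::'a. star (rmul d (star a)))" "rmul (star d) = (\<lambda>a::'a. star (lmul d (star a)))"
  unfolding star_multiplier_def
  by (simp_all add: mul_Abs[OF double_centralizer_star[OF double_centralizer_mul]])

instance
proof
  fix a b :: "'a multiplier" and r :: real and c c' :: complex
  show "c *\<^sub>C (a + b) = c *\<^sub>C a + c *\<^sub>C b" "(c + c') *\<^sub>C a = c *\<^sub>C a + c' *\<^sub>C a"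
    "c *\<^sub>C c' *\<^sub>C a = (c * c') *\<^sub>C a" "c *\<^sub>C a * b = c *\<^sub>C (a * b)" "a * c *\<^sub>C b = c *\<^sub>C (a * b)"
    by (rule mul_ext, simp add: mul_scaleC mul_plus mul_times mul_simps scaleC_add_right
        scaleC_add_left scaleC_scaleC)+
  show "complex_of_real r *\<^sub>C a = r *\<^sub>R a"
    by (rule mul_ext) (simp add: mul_scaleC mul_scaleR scaleC_of_real)
  have le: "norm (c *\<^sub>C a) \<le> cmod c * norm a" for c and a :: "'a multiplier"
    using norm_lmul_le[of a]
    by (intro norm_multiplier_le) (simp_all add: mul_scaleC norm_scaleC mult.assoc mult_left_mono)
  show "norm (c *\<^sub>C a) = cmod c * norm a"
  proof (cases "c = 0")
    case True
    then show ?thesis using le[of c a] norm_ge_zero[of "c *\<^sub>C a"] by simp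
  next
    case False
    have "inverse c *\<^sub>C (c *\<^sub>C a) = a"
      using False cvec.scale_scale cvec.scale_one by (intro mul_ext) (simp add: mul_scaleC)
    then have "norm a \<le> cmod (inverse c) * norm (c *\<^sub>C a)" using le[of "inverse c" "c *\<^sub>C a"] by simp
    then have "cmod c * norm a \<le> norm (c *\<^sub>C a)"
      using False by (simp add: norm_inverse) (simp add: field_simps)
    with le[of c a] show ?thesis by simp
  qed
  show "star (a + b) = star a + star b" "star (c *\<^sub>C a) = cnj c *\<^sub>C star a"
    "star (a * b) = star b * star a" "star (star a) = a"
    by (rule mul_ext, simp add: mul_scaleC mul_plus mul_times mul_star star_star star_add star_scaleC)+
  show "norm (star a * a) = (norm a)\<^sup>2"
  proof (rule antisym)
    \<comment> \<open>As for operators,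
      \<open>star (lmul a x) * lmul a x = star x * lmul (star a * a) x\<close> bounds
      \<open>norm (lmul a x)\<close>. This half of the identity already makes \<open>star\<close>
      isometric, which gives the other half.\<close>
    have ge: "(norm a)\<^sup>2 \<le> norm (star a * a)" for a :: "'a multiplier"
    proof -
      have "norm a \<le> sqrt (norm (star a * a))"
      proof (rule norm_multiplier_le[rotated])
        fix x
        have "star x * lmul (star a * a) x = star (rmul a (star (lmul a x)) * x)"
          by (simp add: mul_times mul_star star_mult)
        also have "\<dots> = star (lmul a x) * lmul a x" by (simp add: mul_simps star_mult star_star)
        finally have "star (lmul a x) * lmul a x = star x * lmul (star a * a) x" ..
        then have "(norm (lmul a x))\<^sup>2 = norm (star x * lmul (star a * a) x)"
          by (simp add: norm_star_mult_self[symmetric])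
        also have "\<dots> \<le> norm x * (norm (star a * a) * norm x)"
          using norm_mult_ineq[of "star x" "lmul (star a * a) x"]
            mult_left_mono[OF norm_lmul_le norm_ge_zero, of x "star a * a" x]
          by (simp only: norm_star)
        finally have "norm (lmul a x) \<le> sqrt (norm (star a * a) * (norm x)\<^sup>2)"
          by (intro real_le_rsqrt) (simp add: power2_eq_square mult.commute mult.left_commute)
        then show "norm (lmul a x) \<le> sqrt (norm (star a * a)) * norm x"
          by (simp add: real_sqrt_mult)
      qed (simp add: norm_multiplier_nonneg)
      then show ?thesis
        using power_mono[of "norm a" "sqrt (norm (star a * a))" 2]
          norm_multiplier_nonneg[of a] norm_multiplier_nonneg[of "star a * a"] by simp
    qed
    then show "(norm a)\<^sup>2 \<le> norm (star a * a)" .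
    have ns: "norm a \<le> norm (star a)" for a :: "'a multiplier"
    proof (cases "norm a = 0")
      case False
      have "norm a * norm a \<le> norm (star a) * norm a"
        using ge[of a] norm_mult_ineq[of "star a" a] by (simp add: power2_eq_square)
      with False norm_multiplier_nonneg[of a] show ?thesis by simp
    qed (simp add: norm_multiplier_nonneg)
    have "star (star a) = a" by (rule mul_ext) (simp add: mul_star star_star)
    then have "norm (star a) \<le> norm a" using ns[of "star a"] by simp
    then have "norm (star a) * norm a \<le> norm a * norm a"
      using norm_multiplier_nonneg by (rule mult_right_mono)
    then show "norm (star a * a) \<le> (norm a)\<^sup>2"
      using norm_mult_ineq[of "star a" a] by (simp add: power2_eq_square)
  qed
qed

end

instance multiplier :: (cstar_algebra) cstar_algebra_1 ..

section \<open>The embedding of \<open>A\<close> into \<open>M(A)\<close> and central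
  multipliers\<close>

lemma double_centralizer_mult: "double_centralizer (\<lambda>b. a * b) (\<lambda>b. b * (a::'a::cstar_algebra))"
  by (simp add: double_centralizer_def bounded_clinear_def bounded_linear_mult_right
      bounded_linear_mult_left mult_scaleC_left mult_scaleC_right mult.assoc)

definition embed :: "'a::cstar_algebra \<Rightarrow> 'a multiplier" where
  "embed a = Abs_multiplier (\<lambda>b. a * b, \<lambda>b. b * a)"

lemma mul_embed: "lmul (embed a) = (\<lambda>b. a * b)" "rmul (embed a) = (\<lambda>b. b * a)"
  unfolding embed_def by (simp_all add: mul_Abs[OF double_centralizer_mult])

lemma embed_add: "embed (a + b) = embed a + embed b"
  and embed_diff: "embed (a - b) = embed a - embed b"
  and embed_mult: "embed (a * b) = embed a * embed b"
  and embed_scaleC: "embed (c *\<^sub>C a) = c *\<^sub>C embed a"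
  and embed_scaleR: "embed (r *\<^sub>R a) = r *\<^sub>R embed a"
  and embed_star: "embed (star a) = star (embed a)"
  and embed_lmul: "embed (lmul d a) = d * embed a"
  and embed_rmul: "embed (rmul d a) = embed a * d"
  by (rule mul_ext, simp add: mul_embed mul_plus mul_diff mul_times mul_scaleC mul_scaleR mul_star
      mul_simps(3,5) star_mult star_star distrib_right left_diff_distrib mult.assoc mult_scaleC_left)+

lemma norm_embed: "norm (embed a) = norm a"
proof (rule antisym)
  show "norm (embed a) \<le> norm a"
    by (rule norm_multiplier_le) (simp_all add: mul_embed norm_mult_ineq)
  show "norm a \<le> norm (embed a)"
  proof (cases "a = 0")
    case False
    have "norm a * norm a \<le> norm (embed a) * norm a"
      using norm_lmul_le[of "embed a" "star a"]
      by (simp add: mul_embed norm_mult_star_self norm_star power2_eq_square)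
    with False show ?thesis by simp
  qed simp
qed

lemma embed_zero: "embed 0 = 0"
  using embed_diff[of 0 0] by simp

lemma embed_eq_iff: "embed a = embed b \<longleftrightarrow> a = b"
  using norm_embed[of "a - b"] by (auto simp: embed_diff)

lemma embed_eq_0_iff: "embed a = 0 \<longleftrightarrow> a = 0"
  using embed_eq_iff[of a 0] by (simp add: embed_zero)

lemma nonneg_embed: "positive a \<Longrightarrow> nonneg (embed a)"
  by (auto simp: positive_def embed_mult embed_star nonneg_star_mult)

text \<open>With equal left and right parts, \<open>d\<close> may be moved between the factors of a
  product, so \<open>b * d (e a)\<close> and \<open>b * e (d a)\<close> agree; \<open>b\<close> is
  arbitrary and cancels.\<close>

lemma center_multiplierI:
  assumes "lmul d = rmul d"
  shows "d \<in> center"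
proof -
  have "d * e = e * d" for e
  proof (rule mul_ext)
    fix a
    have "lmul d (lmul e a) - lmul e (lmul d a) = 0"
    proof -
      have "b * lmul d (lmul e a) = b * lmul e (lmul d a)" for b
      proof -
        have "b * lmul d (lmul e a) = lmul d (b * lmul e a)" unfolding assms by (rule mul_simps(4)[symmetric])
        also have "\<dots> = lmul d (rmul e b * a)" by (simp only: mul_simps(5))
        also have "\<dots> = rmul e b * lmul d a" unfolding assms by (rule mul_simps(4))
        finally show ?thesis by (simp only: mul_simps(5))
      qed
      then have "b * (lmul d (lmul e a) - lmul e (lmul d a)) = 0" for b by (simp add: right_diff_distrib)
      then show ?thesis using star_mult_self_eq_0 by blast
    qed
    then show "lmul (d * e) a = lmul (e * d) a" by (simp add: mul_times)
  qed
  then show ?thesis by (simp add: center_def)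
qed

section \<open>The norm of a Hilbert module\<close>

context pre_hilbert_module
begin

lemma act_zero_left [simp]: "act 0 x = 0"
  using act_add_left[of 0 0 x] by simp

lemma act_zero_right [simp]: "act a 0 = 0"
  using act_add_right[of a 0 0] by simp

lemma act_diff_left: "act (a - b) x = act a x - act b x"
  using act_add_left[of "a - b" b x] by (simp add: algebra_simps)

lemma act_diff_right: "act a (x - y) = act a x - act a y"
  using act_add_right[of a "x - y" y] by (simp add: algebra_simps)

lemma ip_zero_left [simp]: "ip 0 x = 0"
  using ip_add_left[of 0 0 x] by simp

lemma ip_zero_right [simp]: "ip x 0 = 0"
  using ip_add_right[of x 0 0] by simp

lemma ip_diff_left: "ip (x - y) z = ip x z - ip y z"
  using ip_add_left[of "x - y" y z] by (simp add: algebra_simps)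

lemma ip_diff_right: "ip x (y - z) = ip x y - ip x z"
  using ip_add_right[of x "y - z" z] by (simp add: algebra_simps)

lemma self_adjoint_ip: "star (ip x x) = ip x x"
  using ip_star[of x x] by simp

lemma nonneg_embed_ip: "nonneg (embed (ip x x))"
  by (rule nonneg_embed[OF ip_positive])

lemma hnorm_nonneg [simp]: "0 \<le> hnorm x"
  by (simp add: hnorm_def)

lemma hnorm_square: "(hnorm x)\<^sup>2 = norm (ip x x)"
  by (simp add: hnorm_def)

lemma hnorm_eq_0_iff: "hnorm x = 0 \<longleftrightarrow> x = 0"
  by (simp add: hnorm_def ip_eq_0_iff)

lemma hnorm_zero [simp]: "hnorm 0 = 0"
  by (simp add: hnorm_eq_0_iff)

lemma hnorm_scale: "hnorm (scale c x) = cmod c * hnorm x"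
  by (simp add: hnorm_def ip_scale_left ip_scale_right norm_scaleC real_sqrt_mult norm_mult scaleC_scaleC)

lemma hnorm_minus: "hnorm (- x) = hnorm x"
  using hnorm_scale[of "-1" x] by simp

lemma hnorm_minus_commute: "hnorm (x - y) = hnorm (y - x)"
  using hnorm_minus[of "x - y"] by simp

lemma hnorm_act_le: "hnorm (act a x) \<le> norm a * hnorm x"
proof (rule power2_le_imp_le)
  have "(hnorm (act a x))\<^sup>2 = norm (a * (ip x x * star a))"
    by (simp add: hnorm_square ip_act_left ip_act_right mult.assoc)
  also have "\<dots> \<le> norm a * (norm (ip x x) * norm (star a))"
    by (meson norm_mult_ineq mult_left_mono norm_ge_zero order_trans)
  also have "\<dots> = (norm a * hnorm x)\<^sup>2"
    unfolding power_mult_distrib hnorm_square by (simp add: norm_star power2_eq_square)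
  finally show "(hnorm (act a x))\<^sup>2 \<le> (norm a * hnorm x)\<^sup>2" .
qed simp

text \<open>Expand \<open>\<langle>z, z\<rangle> \<ge> 0\<close> for \<open>z = y - t\<langle>y, x\<rangle>x\<close>, \<open>t = 1 / \<parallel>x\<parallel>\<^sup>2\<close>, and use \<open>a\<langle>x, x\<rangle>a\<^sup>* \<le> \<parallel>x\<parallel>\<^sup>2 aa\<^sup>*\<close>.\<close>

lemma norm_ip_le: "norm (ip x y) \<le> hnorm x * hnorm y"
proof (cases "x = 0")
  case False
  define a where "a = ip y x"
  define h where "h = ip x x"
  define N where "N = norm h"
  have N: "0 < N" using False by (simp add: N_def h_def ip_eq_0_iff)
  define t where "t = 1 / N"
  have t: "0 < t" "t * N = 1" using N by (simp_all add: t_def)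
  have sa: "star a = ip x y" using ip_star[of x y] by (simp add: a_def)
  let ?a = "embed a" and ?h = "embed h" and ?y = "embed (ip y y)"
  define z where "z = y - act (t *\<^sub>R a) x"
  have "ip z z = ip y y - (t *\<^sub>R (a * star a) + t *\<^sub>R (a * star a)) + (t * t) *\<^sub>R (a * h * star a)"
    by (simp add: z_def ip_diff_left ip_diff_right ip_act_left ip_act_right sa[symmetric] star_scaleR
        a_def[symmetric] h_def[symmetric] algebra_simps)
  then have z: "embed (ip z z) = ?y - (t *\<^sub>R (?a * star ?a) + t *\<^sub>R (?a * star ?a)) + (t * t) *\<^sub>R (?a * ?h * star ?a)"
    by (simp add: embed_add embed_diff embed_scaleR embed_mult embed_star)
  have "nonneg (N *\<^sub>R 1 - ?h)"
    unfolding h_def by (rule nonneg_norm_minus[OF nonneg_embed_ip]) (simp add: norm_embed N_def h_def)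
  from nonneg_conj[OF this, of "star ?a"]
  have "nonneg ((t * t) *\<^sub>R (?a * (N *\<^sub>R 1 - ?h) * star ?a))"
    using t by (intro nonneg_scaleR) (simp_all add: star_star)
  from nonneg_add[OF nonneg_embed_ip[of z] this]
  have "nonneg (?y - (t *\<^sub>R (?a * star ?a) + t *\<^sub>R (?a * star ?a)) + (t * t * N) *\<^sub>R (?a * star ?a))"
    by (simp add: z algebra_simps)
  moreover have "t * t * N = t" using t by (simp add: mult.assoc)
  ultimately have "nonneg (?y - t *\<^sub>R (?a * star ?a))" by (simp only:) simp
  moreover have "nonneg (t *\<^sub>R (?a * star ?a))"
    using nonneg_star_mult[of "star ?a"] t by (intro nonneg_scaleR) (simp_all add: star_star)
  ultimately have "norm (t *\<^sub>R (?a * star ?a)) \<le> norm ?y" by (intro norm_mono_nonneg)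
  then have "t * (norm a)\<^sup>2 \<le> norm (ip y y)" using t by (simp add: norm_mult_star_self norm_embed)
  then have "N * (t * (norm a)\<^sup>2) \<le> N * norm (ip y y)" using N by simp
  then have "(norm a)\<^sup>2 \<le> N * norm (ip y y)" using t by (simp add: mult.assoc[symmetric] mult.commute)
  then have "(norm (ip x y))\<^sup>2 \<le> (hnorm x * hnorm y)\<^sup>2"
    by (simp add: power_mult_distrib hnorm_square N_def h_def sa[symmetric] norm_star)
  then show ?thesis by (rule power2_le_imp_le) simp
qed simp

lemma hnorm_triangle: "hnorm (x + y) \<le> hnorm x + hnorm y"
proof (rule power2_le_imp_le)
  have "(hnorm (x + y))\<^sup>2 = norm ((ip x x + ip x y) + (ip y x + ip y y))"
    by (simp add: hnorm_square ip_add_left ip_add_right algebra_simps)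
  also have "\<dots> \<le> (norm (ip x x) + norm (ip x y)) + (norm (ip y x) + norm (ip y y))"
    by (intro norm_triangle_le add_mono norm_triangle_ineq)
  also have "\<dots> \<le> (hnorm x)\<^sup>2 + hnorm x * hnorm y + (hnorm y * hnorm x + (hnorm y)\<^sup>2)"
    using norm_ip_le[of x y] norm_ip_le[of y x] by (simp add: hnorm_square mult.commute)
  finally show "(hnorm (x + y))\<^sup>2 \<le> (hnorm x + hnorm y)\<^sup>2"
    by (simp add: power2_eq_square algebra_simps)
qed simp

lemma hnorm_triangle_diff: "hnorm (x - y) \<le> hnorm x + hnorm y"
  using hnorm_triangle[of x "- y"] by (simp add: hnorm_minus)

lemma act_eq_0_of_conj: "a * ip x x * star a = 0 \<Longrightarrow> act a x = 0"
  using ip_eq_0_iff[of "act a x"] by (simp add: ip_act_left ip_act_right mult.assoc)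

text \<open>With \<open>h = ip x x\<close> and \<open>y\<close> the inverse of \<open>h + r\<close>,
  the product \<open>a = y * h\<close> lies in \<open>A\<close> although \<open>y\<close> need not.
  The squared distance is the norm of \<open>(1 - a) * h * (1 - a) = r\<^sup>2 * y * h * y\<close>,
  at most \<open>2 * r\<close>, whence \<open>r = e\<^sup>2 / 4\<close>.\<close>

lemma approximate_unit:
  assumes "0 < e"
  obtains a where "hnorm (x - act a x) < e"
proof -
  define r where "r = e\<^sup>2 / 4"
  have r: "0 < r" "2 * r < e\<^sup>2" using assms by (simp_all add: r_def)
  let ?h = "embed (ip x x)"
  obtain y where y: "y * (?h + r *\<^sub>R 1) = 1" "norm y \<le> 1 / r" "self_adjoint y"
    using resolvent[OF nonneg_embed_ip r(1)] by metis
  define a where "a = lmul y (ip x x)"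
  have a: "embed a = 1 - r *\<^sub>R y"
    using y(1) by (simp add: a_def embed_lmul algebra_simps)
  have yh: "y * ?h = 1 - r *\<^sub>R y" using y(1) by (simp add: algebra_simps)
  have "embed (ip (x - act a x) (x - act a x)) = (1 - embed a) * ?h * (1 - star (embed a))"
  proof -
    have "ip (x - act a x) (x - act a x) = ip x x - a * ip x x - (ip x x - a * ip x x) * star a"
      by (simp add: ip_diff_left ip_diff_right ip_act_left ip_act_right left_diff_distrib mult.assoc)
    then show ?thesis
      by (simp only: embed_diff embed_mult embed_star) (simp add: left_diff_distrib right_diff_distrib)
  qed
  also have "\<dots> = (r * r) *\<^sub>R (y * ?h * y)"
    using y(3) by (simp add: a star_diff star_scaleR self_adjoint_def)
  also have "\<dots> = (r * r) *\<^sub>R ((1 - r *\<^sub>R y) * y)" by (simp only: yh)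
  finally have "(hnorm (x - act a x))\<^sup>2 = (r * r) * norm ((1 - r *\<^sub>R y) * y)"
    unfolding hnorm_square by (subst norm_embed[symmetric]) simp
  also have "\<dots> \<le> (r * r) * (2 * (1 / r))"
  proof (intro mult_left_mono)
    have "norm (r *\<^sub>R y) \<le> 1" using y(2) r by (simp add: field_simps)
    then have "norm (1 - r *\<^sub>R y) \<le> 2"
      using norm_triangle_ineq4[of 1 "r *\<^sub>R y"] norm_one_le[where 'a="'a multiplier"] by linarith
    then show "norm ((1 - r *\<^sub>R y) * y) \<le> 2 * (1 / r)"
      using y(2) by (intro order_trans[OF norm_mult_ineq] mult_mono) auto
  qed (use r in simp)
  also have "\<dots> = 2 * r" using r by simp
  finally have "(hnorm (x - act a x))\<^sup>2 < e\<^sup>2" using r by linarith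
  then have "hnorm (x - act a x) < e" using assms by (simp add: power2_less_imp_less)
  then show ?thesis by (rule that)
qed

end

section \<open>Uniqueness of the extended action\<close>

context hilbert_module
begin

text \<open>The description in \<open>mact\<close> is unambiguous: bounded operators that agree on
  all \<open>act a x\<close> agree everywhere, since by \<open>approximate_unit\<close> such vectors
  come arbitrarily close to \<open>x\<close>.\<close>

lemma mact_eqI:
  assumes T: "bounded_operator T" and ext: "\<And>a x. T (act a x) = act (lmul d a) x"
  shows "mact d = T"
  unfolding mact_def
proof (rule the_equality)
  fix S assume S: "bounded_operator S \<and> (\<forall>a x. S (act a x) = act (lmul d a) x)"
  show "S = T"
  proof
    fix x
    obtain K where K: "\<And>x. hnorm (S x) \<le> K * hnorm x" using S by (auto simp: bounded_operator_def)
    obtain L where L: "\<And>x. hnorm (T x) \<le> L * hnorm x" using T by (auto simp: bounded_operator_def)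
    have S_diff: "S (x - y) = S x - S y" and T_diff: "T (x - y) = T x - T y" for x y
      using S T by (auto simp: bounded_operator_def Vector_Spaces.linear_iff_module_hom module_hom.diff)
    have le: "hnorm (S x - T x) \<le> (\<bar>K\<bar> + \<bar>L\<bar> + 1) * e" if e: "0 < e" for e
    proof -
      obtain a where a: "hnorm (x - act a x) < e" using approximate_unit[OF e] by blast
      let ?y = "x - act a x"
      have "S x - T x = S ?y - T ?y" using S ext by (simp add: S_diff T_diff)
      then have "hnorm (S x - T x) \<le> K * hnorm ?y + L * hnorm ?y"
        using hnorm_triangle_diff[of "S ?y" "T ?y"] K[of ?y] L[of ?y] by simp
      also have "\<dots> \<le> (\<bar>K\<bar> + \<bar>L\<bar> + 1) * hnorm ?y"
        by (simp add: distrib_right[symmetric] mult_right_mono)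
      also have "\<dots> \<le> (\<bar>K\<bar> + \<bar>L\<bar> + 1) * e" using a by (intro mult_left_mono) auto
      finally show ?thesis .
    qed
    have "hnorm (S x - T x) \<le> 0"
    proof (rule field_le_epsilon)
      fix e :: real assume "0 < e"
      then show "hnorm (S x - T x) \<le> 0 + e" using le[of "e / (\<bar>K\<bar> + \<bar>L\<bar> + 1)"] by simp
    qed
    then show "S x = T x" using hnorm_eq_0_iff[of "S x - T x"] hnorm_nonneg[of "S x - T x"] by simp
  qed
qed (use assms in auto)

end

section \<open>Full modules: norm from the action, uniform boundedness\<close>

context full_hilbert_module
begin

text \<open>Fullness enters through \<open>W\<close>, the \<open>b\<close> with
  \<open>norm (h ^ n * b) = O(r ^ n)\<close>: a subspace containing all inner products, as
  \<open>h ^ n\<close> moves onto the first argument. The constant depends on \<open>b\<close>, so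
  \<open>W\<close> need not be closed; but one \<open>b\<close> within \<open>norm h / 2\<close> of
  \<open>h\<close> suffices, because the error absorbs only half of
  \<open>norm h ^ (n + 1)\<close>.\<close>

lemma norm_le_of_act_bound_self_adjoint:
  assumes h: "self_adjoint h" and r: "0 \<le> r" and le: "\<And>u. hnorm (act h u) \<le> r * hnorm u"
  shows "norm h \<le> r"
proof (cases "h = 0")
  case False
  let ?h = "embed h"
  have sa: "self_adjoint ?h" using h by (simp add: self_adjoint_def embed_star[symmetric])
  define W where "W = {b. \<exists>C. \<forall>n. norm (?h ^ n * embed b) \<le> C * r ^ n}"
  have iter: "?h ^ n * embed (ip u v) = embed (ip ((act h ^^ n) u) v)" for n u v
    by (induction n) (simp_all add: mult.assoc embed_mult[symmetric] ip_act_left)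
  have iter_le: "hnorm ((act h ^^ n) u) \<le> r ^ n * hnorm u" for n u
  proof (induction n)
    case (Suc n)
    have "hnorm ((act h ^^ Suc n) u) \<le> r * hnorm ((act h ^^ n) u)" using le by simp
    also have "\<dots> \<le> r * (r ^ n * hnorm u)" using Suc r by (rule mult_left_mono)
    finally show ?case by simp
  qed simp
  have W_ip: "{ip x y | x y. True} \<subseteq> W"
  proof clarify
    fix u v
    have "norm (?h ^ n * embed (ip u v)) \<le> (hnorm u * hnorm v) * r ^ n" for n
    proof -
      have "norm (?h ^ n * embed (ip u v)) \<le> hnorm ((act h ^^ n) u) * hnorm v"
        by (simp only: iter norm_embed norm_ip_le)
      also have "\<dots> \<le> (r ^ n * hnorm u) * hnorm v" by (intro mult_right_mono iter_le) simp
      finally show ?thesis by (simp add: mult.commute mult.left_commute)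
    qed
    then show "ip u v \<in> W" by (auto simp: W_def)
  qed
  have "cvec.subspace W"
  proof (rule cvec.subspaceI)
    show "0 \<in> W" by (auto simp: W_def embed_zero intro!: exI[of _ 0])
  next
    fix a b assume "a \<in> W" "b \<in> W"
    then obtain C D where CD: "\<And>n. norm (?h ^ n * embed a) \<le> C * r ^ n"
      "\<And>n. norm (?h ^ n * embed b) \<le> D * r ^ n" by (auto simp: W_def)
    have "norm (?h ^ n * embed (a + b)) \<le> (C + D) * r ^ n" for n
      using norm_triangle_ineq[of "?h ^ n * embed a" "?h ^ n * embed b"] CD[of n]
      by (simp add: embed_add algebra_simps)
    then show "a + b \<in> W" by (auto simp: W_def)
  next
    fix c a assume "a \<in> W"
    then obtain C where C: "\<And>n. norm (?h ^ n * embed a) \<le> C * r ^ n" by (auto simp: W_def)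
    have "norm (?h ^ n * embed (c *\<^sub>C a)) \<le> (cmod c * C) * r ^ n" for n
      using mult_left_mono[OF C[of n], of "cmod c"]
      by (simp add: embed_scaleC mult_scaleC_right norm_scaleC mult.assoc)
    then show "c *\<^sub>C a \<in> W" by (auto simp: W_def)
  qed
  then have W: "cvec.span {ip x y | x y. True} \<subseteq> W" by (rule cvec.span_minimal[OF W_ip])
  have "h \<in> closure (cvec.span {ip x y | x y. True})" using full by simp
  then have "\<forall>e>0. \<exists>b\<in>cvec.span {ip x y | x y. True}. dist b h < e"
    by (simp only: closure_approachable)
  moreover have "0 < norm h / 2" using False by simp
  ultimately obtain b where "b \<in> cvec.span {ip x y | x y. True}" and b: "dist b h < norm h / 2"
    by blast
  then have "b \<in> W" using W by blast
  then obtain C where C: "\<And>n. norm (?h ^ n * embed b) \<le> C * r ^ n" by (auto simp: W_def)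
  have "norm h ^ n \<le> (2 * \<bar>C\<bar> / norm h) * real (n + 1) * r ^ n" if n: "0 < n" for n
  proof -
    have "norm h ^ n * norm h = norm (?h ^ n * ?h)"
      using norm_power_self_adjoint[OF sa, of "Suc n"]
      by (simp add: power_commutes norm_embed mult.commute)
    also have "\<dots> = norm (?h ^ n * embed b + ?h ^ n * embed (h - b))"
      by (simp add: embed_diff algebra_simps)
    also have "\<dots> \<le> C * r ^ n + norm h ^ n * (norm h / 2)"
    proof (intro norm_triangle_le add_mono C)
      have "norm (?h ^ n * embed (h - b)) \<le> norm (?h ^ n) * norm (h - b)"
        using norm_mult_ineq[of "?h ^ n" "embed (h - b)"] by (simp only: norm_embed)
      also have "\<dots> \<le> norm h ^ n * (norm h / 2)"
        using b by (intro mult_mono) (simp_all add: norm_power_self_adjoint[OF sa n] norm_embed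
            dist_norm norm_minus_commute)
      finally show "norm (?h ^ n * embed (h - b)) \<le> norm h ^ n * (norm h / 2)" .
    qed
    finally have "norm h ^ n * norm h \<le> 2 * (C * r ^ n)" by simp
    also have "\<dots> \<le> 2 * (\<bar>C\<bar> * (real (n + 1) * r ^ n))"
    proof -
      have "C * r ^ n \<le> \<bar>C\<bar> * r ^ n" using r by (intro mult_right_mono) auto
      also have "\<dots> \<le> \<bar>C\<bar> * (real (n + 1) * r ^ n)"
        using r by (intro mult_left_mono) (simp_all add: mult_le_cancel_right1 algebra_simps)
      finally show ?thesis by simp
    qed
    finally show ?thesis using False by (simp add: field_simps)
  qed
  then show ?thesis by (rule linear_over_exponential_bound[OF r])
qed (use r in simp)

lemma norm_le_of_act_bound:
  assumes r: "0 \<le> r" and le: "\<And>u. hnorm (act c u) \<le> r * hnorm u"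
  shows "norm c \<le> r"
proof (cases "c = 0")
  case False
  have "norm (star c * c) \<le> norm c * r"
  proof (rule norm_le_of_act_bound_self_adjoint[OF self_adjoint_star_mult])
    fix u
    have "hnorm (act (star c * c) u) \<le> norm (star c) * hnorm (act c u)"
      by (simp only: act_mult hnorm_act_le)
    also have "\<dots> \<le> norm c * (r * hnorm u)"
      using le[of u] by (simp add: norm_star mult_left_mono)
    finally show "hnorm (act (star c * c) u) \<le> norm c * r * hnorm u" by (simp add: mult.assoc)
  qed (use r in simp)
  with False show ?thesis by (simp add: norm_star_mult_self power2_eq_square)
qed (use r in simp)

lemma act_faithful: "(\<And>u. act c u = 0) \<Longrightarrow> c = 0"
  using norm_le_of_act_bound[of 0 c] by simp

text \<open>Sokal's gliding hump: at step \<open>n\<close> move by \<open>3\<^sup>-\<^sup>n\<close> in a direction in which \<open>b n\<close> is almost maximal.\<close>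

theorem uniform_boundedness:
  assumes ptw: "\<And>x. \<exists>C. \<forall>b\<in>F. hnorm (act b x) \<le> C"
  shows "\<exists>C. \<forall>b\<in>F. norm b \<le> C"
proof (rule ccontr)
  assume unbounded: "\<not> ?thesis"
  then have "\<forall>n::nat. \<exists>b\<in>F. 4 ^ n < norm b" by (meson not_le)
  then obtain b :: "nat \<Rightarrow> 'b" where b: "\<And>n. b n \<in> F" "\<And>n. 4 ^ n < norm (b n)" by metis
  have step: "\<exists>x'. hnorm (x' - x) \<le> (1/3) ^ n \<and> (2/3) * (1/3) ^ n * norm (b n) \<le> hnorm (act (b n) x')"
    for x n
  proof -
    have "0 < norm (b n)" using b(2)[of n] by (meson less_trans zero_less_power zero_less_numeral)
    then have "\<not> (\<forall>u. hnorm (act (b n) u) \<le> (2/3) * norm (b n) * hnorm u)"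
      using norm_le_of_act_bound[of "(2/3) * norm (b n)" "b n"] by auto
    then obtain u where u: "(2/3) * norm (b n) * hnorm u < hnorm (act (b n) u)"
      by (auto simp: not_le)
    have "u \<noteq> 0" using u by auto
    then have u0: "0 < hnorm u" using hnorm_eq_0_iff[of u] hnorm_nonneg[of u] by linarith
    define w where "w = scale (complex_of_real ((1/3) ^ n / hnorm u)) u"
    have w: "hnorm w = (1/3) ^ n" using u0 by (simp add: w_def hnorm_scale norm_divide norm_power)
    have aw: "hnorm (act (b n) w) = (1/3) ^ n / hnorm u * hnorm (act (b n) u)"
      using u0 by (simp add: w_def act_scale_right hnorm_scale norm_divide norm_power)
    have "(2/3) * (1/3) ^ n * norm (b n) = (1/3) ^ n / hnorm u * ((2/3) * norm (b n) * hnorm u)"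
      using u0 by simp
    also have "\<dots> \<le> hnorm (act (b n) w)"
      unfolding aw using u u0 by (intro mult_left_mono) auto
    finally have aw': "(2/3) * (1/3) ^ n * norm (b n) \<le> hnorm (act (b n) w)" .
    \<comment> \<open>\<open>act (b n) w\<close> is half the difference of the values at
      \<open>x + w\<close> and \<open>x - w\<close>, so one of these is at least as large.\<close>
    have "scale 2 (act (b n) w) = act (b n) (x + w) - act (b n) (x - w)"
      using scale_left_distrib[of 1 1 "act (b n) w"] by (simp add: act_add_right act_diff_right)
    then have "2 * hnorm (act (b n) w) \<le> hnorm (act (b n) (x + w)) + hnorm (act (b n) (x - w))"
      using hnorm_scale[of 2 "act (b n) w"] hnorm_triangle_diff by (metis norm_numeral)
    then have "hnorm (act (b n) w) \<le> hnorm (act (b n) (x + w)) \<or>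
        hnorm (act (b n) w) \<le> hnorm (act (b n) (x - w))" by linarith
    then show ?thesis
    proof
      assume "hnorm (act (b n) w) \<le> hnorm (act (b n) (x + w))"
      then show ?thesis using aw' w by (intro exI[of _ "x + w"]) simp
    next
      assume "hnorm (act (b n) w) \<le> hnorm (act (b n) (x - w))"
      then show ?thesis using aw' w by (intro exI[of _ "x - w"]) (simp add: hnorm_minus)
    qed
  qed
  then obtain S where S: "\<And>x n. hnorm (S x n - x) \<le> (1/3) ^ n"
    "\<And>x n. (2/3) * (1/3) ^ n * norm (b n) \<le> hnorm (act (b n) (S x n))" by metis
  define xs where "xs = rec_nat 0 (\<lambda>n x. S x n)"
  have xs: "xs (Suc n) = S (xs n) n" for n by (simp add: xs_def)
  \<comment> \<open>\<open>g n\<close> is the sum of the remaining step lengths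
    \<open>(1/3) ^ k\<close> for \<open>k \<ge> n\<close>.\<close>
  define g :: "nat \<Rightarrow> real" where "g n = (3/2) * (1/3) ^ n" for n
  have tele: "hnorm (xs (n + k) - xs n) \<le> g n - g (n + k)" for n k
  proof (induction k)
    case (Suc k)
    have "hnorm (xs (n + Suc k) - xs n) \<le> hnorm (xs (Suc (n + k)) - xs (n + k)) + hnorm (xs (n + k) - xs n)"
      using hnorm_triangle[of "xs (Suc (n + k)) - xs (n + k)" "xs (n + k) - xs n"] by simp
    also have "\<dots> \<le> (1/3) ^ (n + k) + (g n - g (n + k))"
      using S(1) Suc by (intro add_mono) (simp_all add: xs)
    finally show ?case by (simp add: g_def)
  qed simp
  have tail: "hnorm (xs m - xs n) \<le> g n" if "n \<le> m" for m n
  proof -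
    have "0 \<le> g m" by (simp add: g_def)
    then show ?thesis using tele[of n "m - n"] that by simp
  qed
  have g0: "g \<longlonglongrightarrow> 0"
    unfolding g_def by (intro tendsto_mult_right_zero LIMSEQ_power_zero) simp
  have "\<exists>l. (\<lambda>n. hnorm (xs n - l)) \<longlonglongrightarrow> 0"
  proof (rule complete, intro allI impI)
    fix e :: real assume "0 < e"
    then obtain N where N: "\<And>n. n \<ge> N \<Longrightarrow> g n < e"
      using LIMSEQ_D[OF g0, of e] by (auto simp: abs_less_iff)
    have "hnorm (xs m - xs n) < e" if "N \<le> n" "N \<le> m" for m n
      using tail[of n m] tail[of m n] N[OF that(1)] N[OF that(2)] hnorm_minus_commute[of "xs m" "xs n"]
      by (cases "n \<le> m") auto
    then show "\<exists>N. \<forall>m\<ge>N. \<forall>n\<ge>N. hnorm (xs m - xs n) < e" by blast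
  qed
  then obtain l where l: "(\<lambda>n. hnorm (xs n - l)) \<longlonglongrightarrow> 0" by blast
  have lx: "hnorm (xs n - l) \<le> g n" for n
  proof (rule field_le_epsilon)
    fix e :: real assume "0 < e"
    then obtain N where N: "\<And>m. m \<ge> N \<Longrightarrow> hnorm (xs m - l) < e"
      using LIMSEQ_D[OF l, of e] by auto
    let ?m = "max N n"
    have "hnorm (xs n - l) \<le> hnorm (xs n - xs ?m) + hnorm (xs ?m - l)"
      using hnorm_triangle[of "xs n - xs ?m" "xs ?m - l"] by simp
    then show "hnorm (xs n - l) \<le> g n + e"
      using tail[of n ?m] N[of ?m] hnorm_minus_commute[of "xs n" "xs ?m"] by simp
  qed
  \<comment> \<open>The limit is within \<open>g (n+1) = (1/2) * (1/3) ^ n\<close> of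
    \<open>xs (n+1)\<close>, so \<open>2/3 - 1/2 = 1/6\<close> of the gain survives, and
    \<open>norm (b n) > 4 ^ n\<close> outgrows \<open>3 ^ n\<close>.\<close>
  have big: "(1/6) * (4/3) ^ n \<le> hnorm (act (b n) l)" for n
  proof -
    have "(2/3) * (1/3) ^ n * norm (b n) \<le> hnorm (act (b n) (xs (Suc n)))" using S(2) by (simp add: xs)
    also have "\<dots> \<le> hnorm (act (b n) (xs (Suc n) - l)) + hnorm (act (b n) l)"
      using hnorm_triangle[of "act (b n) (xs (Suc n) - l)" "act (b n) l"] by (simp add: act_diff_right)
    also have "hnorm (act (b n) (xs (Suc n) - l)) \<le> norm (b n) * g (Suc n)"
      using hnorm_act_le lx by (meson mult_left_mono norm_ge_zero order_trans)
    finally have "(1/6) * ((1/3) ^ n * norm (b n)) \<le> hnorm (act (b n) l)"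
      by (simp add: g_def mult.commute)
    moreover have "(1/3) ^ n * 4 ^ n \<le> (1/3) ^ n * norm (b n)" using b(2)[of n] by simp
    moreover have "(1/3) ^ n * 4 ^ n = (4/3 :: real) ^ n" by (simp add: power_mult_distrib[symmetric])
    ultimately show ?thesis by linarith
  qed
  obtain C where C: "\<forall>b\<in>F. hnorm (act b l) \<le> C" using ptw by blast
  obtain n where "6 * C < (4/3) ^ n" using real_arch_pow[of "4/3" "6 * C"] by auto
  moreover have "hnorm (act (b n) l) \<le> C" using C b(1) by blast
  ultimately show False using big[of n] by linarith
qed

end

section \<open>Orthogonality preserving morphisms\<close>

locale orthogonality_preserving_morphism = full_hilbert_module scale act ip
  for scale :: "complex \<Rightarrow> 'x::ab_group_add \<Rightarrow> 'x"
    and act :: "'a::cstar_algebra \<Rightarrow> 'x \<Rightarrow> 'x"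
    and ip :: "'x \<Rightarrow> 'x \<Rightarrow> 'a" +
  fixes T :: "'x \<Rightarrow> 'x"
  assumes morphism: "bounded_morphism T"
    and orth: "ip x z = 0 \<Longrightarrow> ip (T x) z = 0"
begin

lemma T_module_hom: "module_hom scale scale T"
  using morphism by (simp add: bounded_morphism_def bounded_operator_def Vector_Spaces.linear_iff_module_hom)

lemmas T_add = module_hom.add[OF T_module_hom]
  and T_diff = module_hom.diff[OF T_module_hom]
  and T_scale = module_hom.scale[OF T_module_hom]
  and T_zero = module_hom.zero[OF T_module_hom]

lemma T_act: "T (act a x) = act a (T x)"
  using morphism by (simp add: bounded_morphism_def)

lemma T_bound: obtains K where "0 \<le> K" "\<And>x. hnorm (T x) \<le> K * hnorm x"
proof -
  obtain K where K: "\<And>x. hnorm (T x) \<le> K * hnorm x"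
    using morphism by (auto simp: bounded_morphism_def bounded_operator_def)
  have "hnorm (T x) \<le> \<bar>K\<bar> * hnorm x" for x
    by (rule order_trans[OF K]) (simp add: mult_right_mono)
  then show ?thesis using that[of "\<bar>K\<bar>"] by simp
qed

text \<open>
  For \<open>a\<close>, \<open>b\<close> in the bicommutant of \<open>h = \<langle>x, x\<rangle>\<close> with \<open>ab = 0\<close>, the vectors \<open>ahx\<close> and \<open>bhx\<close> are
  orthogonal.  So \<open>h\<langle>Tx, x\<rangle>h\<close> is local with respect to \<open>h\<close>.
\<close>

lemma ip_T_local: "ip x x * (ip x x * ip (T x) x * ip x x) = (ip x x * ip (T x) x * ip x x) * ip x x"
proof -
  define h where "h = ip x x"
  define p where "p = ip (T x) x"
  let ?h = "embed h" and ?p = "embed p"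
  have sh: "star h = h" by (simp add: h_def self_adjoint_ip)
  have "?h * (?h * ?p * ?h) = (?h * ?p * ?h) * ?h"
  proof (rule local_imp_commute)
    show "nonneg ?h" unfolding h_def by (rule nonneg_embed_ip)
  next
    fix a b assume ab: "self_adjoint a" "self_adjoint b" "bicommutes ?h a" "bicommutes ?h b" "a * b = 0"
    have hb: "?h * b = b * ?h" using bicommutes_commute[OF bicommutes_refl ab(4)] .
    have sb: "star (embed (lmul b h)) = ?h * b"
      using ab(2) by (simp add: embed_lmul star_mult embed_star[symmetric] sh self_adjoint_def)
    have hb': "?h * (b * z) = b * (?h * z)" for z
      unfolding mult.assoc[symmetric] by (simp only: hb)
    have "ip (act (lmul a h) x) (act (lmul b h) x) = lmul a h * h * star (lmul b h)"
      by (simp add: ip_act_left ip_act_right h_def mult.assoc)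
    then have "embed (ip (act (lmul a h) x) (act (lmul b h) x)) =
        embed (lmul a h) * ?h * star (embed (lmul b h))"
      by (simp only: embed_mult embed_star)
    also have "\<dots> = embed (lmul a h) * ?h * (?h * b)" by (simp only: sb)
    also have "\<dots> = (a * b) * (?h * ?h * ?h)" by (simp only: embed_lmul mult.assoc hb hb')
    finally have "ip (act (lmul a h) x) (act (lmul b h) x) = 0" by (simp add: ab embed_eq_0_iff)
    then have "ip (T (act (lmul a h) x)) (act (lmul b h) x) = 0" by (rule orth)
    then have "lmul a h * p * star (lmul b h) = 0"
      by (simp add: T_act ip_act_left ip_act_right p_def mult.assoc)
    then have "embed (lmul a h) * ?p * star (embed (lmul b h)) = 0"
      by (simp only: embed_mult[symmetric] embed_star[symmetric] embed_eq_0_iff)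
    then show "a * (?h * ?p * ?h) * b = 0" by (simp only: sb) (simp add: embed_lmul mult.assoc)
  qed
  then have "embed (h * (h * p * h)) = embed ((h * p * h) * h)" by (simp only: embed_mult)
  then show ?thesis by (simp only: embed_eq_iff h_def p_def)
qed

text \<open>For the commutator \<open>q\<close> of \<open>h\<close> and \<open>p\<close>, locality
  gives \<open>h * q * h = 0\<close>, so \<open>h * q\<close> kills \<open>x\<close>. Pairing with
  \<open>T x\<close> gives \<open>h * q * star p = 0\<close> and then \<open>h * q = 0\<close>. Now
  \<open>star q\<close> kills \<open>x\<close>, hence \<open>T x\<close>; so
  \<open>star q * p = 0\<close> and finally \<open>star q * q = 0\<close>.\<close>

lemma ip_T_commute: "ip x x * ip (T x) x = ip (T x) x * ip x x"
proof -
  define h where "h = ip x x"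
  define p where "p = ip (T x) x"
  define q where "q = h * p - p * h"
  have sh: "star h = h" by (simp add: h_def self_adjoint_ip)
  have ps: "ip x (T x) = star p" using ip_star[of x "T x"] by (simp add: p_def)
  have hqh: "h * q * h = 0"
    using ip_T_local[of x, folded h_def p_def] by (simp add: q_def algebra_simps)
  have sq: "star q = star p * h - h * star p" by (simp add: q_def star_diff star_mult sh)
  have "act (h * q) x = 0"
    by (rule act_eq_0_of_conj) (simp add: h_def[symmetric] hqh)
  then have "ip (act (h * q) x) (T x) = 0" by simp
  then have hqp: "h * q * star p = 0" by (simp add: ip_act_left ps)
  have "h * q * star (h * q) = (h * q * star p * h - h * q * h * star p) * h"
    by (simp add: star_mult sh sq algebra_simps)
  then have hq: "h * q = 0" using mult_star_self_eq_0[of "h * q"] by (simp add: hqp hqh)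
  have qh: "star q * h = 0" using arg_cong[OF hq, of star] by (simp add: star_mult sh)
  then have "act (star q) x = 0" by (intro act_eq_0_of_conj) (simp add: h_def[symmetric])
  then have "act (star q) (T x) = 0" by (metis T_act T_zero)
  then have "ip (act (star q) (T x)) x = 0" by simp
  then have qp: "star q * p = 0" by (simp add: ip_act_left p_def)
  have "star q * q = star q * h * p - star q * p * h" by (simp add: q_def algebra_simps)
  then have "q = 0" using star_mult_self_eq_0[of q] by (simp add: qh qp)
  then show ?thesis by (simp add: q_def h_def p_def)
qed

text \<open>
  With \<open>u = (h - r)\<^sup>+\<close> and \<open>y = (r + u)\<^sup>-\<^sup>1\<close> one has \<open>y h u = u\<close>.  This makes \<open>w - \<langle>w, x\<rangle>yx\<close>
  orthogonal to \<open>uhx\<close>.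
\<close>

lemma ip_T_mult: "ip (T w) x * ip x x = ip w x * ip (T x) x"
proof -
  define h where "h = ip x x"
  define p where "p = ip (T x) x"
  define g where "g = ip w x"
  define f where "f = ip (T w) x"
  let ?h = "embed h" and ?p = "embed p" and ?g = "embed g" and ?f = "embed f"
  define s where "s = ?f * ?h - ?g * ?p"
  have sh: "star h = h" by (simp add: h_def self_adjoint_ip)
  have hp: "?p * ?h = ?h * ?p"
    using ip_T_commute[of x, folded h_def p_def] by (simp add: embed_mult[symmetric])
  \<comment> \<open>Once \<open>s * u = 0\<close>, only \<open>s * (r - v)\<close> remains of
    \<open>s * h\<close>, and \<open>norm v \<le> r\<close>. Letting \<open>r\<close> tend to 0
    yields \<open>s * h = 0\<close>.\<close>
  have "norm (s * ?h) \<le> 2 * r * norm s" if r: "0 < r" for r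
  proof -
    have nh: "nonneg ?h" unfolding h_def by (rule nonneg_embed_ip)
    obtain u v where uv: "nonneg u" "nonneg v" "bicommutes ?h u" "bicommutes ?h v"
      "?h - r *\<^sub>R 1 = u - v" "u * v = 0" "norm v \<le> r"
      using truncation[OF nh less_imp_le[OF r]] by metis
    obtain y where y: "y * (u + r *\<^sub>R 1) = 1" "bicommutes u y"
      using resolvent[OF uv(1) r] by metis
    have by_: "bicommutes ?h y" using bicommutes_trans[OF uv(3) y(2)] .
    have comm: "?h * u = u * ?h" "v * u = u * v" "?p * y = y * ?p" "?p * u = u * ?p"
      using bicommutes_commute[OF bicommutes_refl uv(3)] bicommutes_commute[OF uv(4,3)]
        bicommutesD[OF by_ hp] bicommutesD[OF uv(3) hp] by auto
    have hr: "?h = (u + r *\<^sub>R 1) - v" using uv(5) by (simp add: algebra_simps)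
    have hu: "?h * u = (u + r *\<^sub>R 1) * u" by (subst hr) (simp add: algebra_simps comm uv)
    have yhu: "y * ?h * u = u"
    proof -
      have "y * ?h * u = y * (u + r *\<^sub>R 1) * u" by (simp only: mult.assoc hu)
      then show ?thesis by (simp only: y(1)) simp
    qed
    have su: "star (embed (lmul u h)) = ?h * u"
      using nonneg_self_adjoint[OF uv(1)]
      by (simp add: embed_lmul star_mult embed_star[symmetric] sh self_adjoint_def)
    define w' where "w' = w - act (rmul y g) x"
    define z where "z = act (lmul u h) x"
    have "embed (ip w' z) = (?g - ?g * y * ?h) * (?h * u)"
      by (simp add: w'_def z_def ip_diff_left ip_act_left ip_act_right embed_mult embed_diff
          embed_star su embed_rmul g_def[symmetric] h_def[symmetric] algebra_simps)
    also have "\<dots> = ?g * (u - y * ?h * u) * ?h" by (simp only: comm(1)) (simp add: algebra_simps)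
    finally have "ip w' z = 0" by (simp add: yhu embed_eq_0_iff)
    then have "ip (T w') z = 0" by (rule orth)
    then have "embed (ip (T w') z) = 0" by (simp add: embed_zero)
    moreover have "embed (ip (T w') z) = (?f - ?g * y * ?p) * (?h * u)"
      by (simp add: w'_def z_def T_diff T_act ip_diff_left ip_act_left ip_act_right embed_mult embed_diff
          embed_star su embed_rmul f_def[symmetric] p_def[symmetric] algebra_simps)
    ultimately have "?f * ?h * u = ?g * (y * ?p * ?h * u)" by (simp add: algebra_simps)
    also have "y * ?p * ?h * u = ?p * (y * ?h * u)"
      using comm(3) by (simp add: mult.assoc[symmetric])
    also have "\<dots> = ?p * u" by (simp only: yhu)
    finally have su0: "s * u = 0" by (simp add: s_def algebra_simps)
    then have "s * ?h = r *\<^sub>R s - s * v" by (subst hr) (simp add: algebra_simps)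
    then have "norm (s * ?h) \<le> r * norm s + norm s * norm v"
      using norm_triangle_ineq4[of "r *\<^sub>R s" "s * v"] norm_mult_ineq[of s v] r by simp
    also have "norm s * norm v \<le> norm s * r" using uv(7) by (simp add: mult_left_mono)
    finally show ?thesis by simp
  qed
  then have le: "norm (s * ?h) \<le> 0 + e" if "0 < e" for e
  proof (cases "s = 0")
    case False
    then show ?thesis
      using \<open>\<And>r. 0 < r \<Longrightarrow> norm (s * ?h) \<le> 2 * r * norm s\<close>[of "e / (2 * norm s)"] that by simp
  qed (use that in simp)
  then have "norm (s * ?h) \<le> 0" by (rule field_le_epsilon)
  then have "s * ?h = 0" by simp
  then have sh0: "(f * h - g * p) * h = 0"
    by (simp add: s_def embed_mult[symmetric] embed_diff[symmetric] embed_eq_0_iff)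
  \<comment> \<open>The last factor \<open>h\<close> is removed by realising
    \<open>f * h - g * p\<close> as the inner product of \<open>v\<close> with \<open>x\<close>:
    this element kills \<open>x\<close>, so its product with its own adjoint vanishes.\<close>
  define v where "v = act f x - act g (T x)"
  have fv: "ip v x = f * h - g * p"
    by (simp add: v_def ip_diff_left ip_act_left h_def p_def)
  have "act (f * h - g * p) x = 0"
    by (rule act_eq_0_of_conj) (simp add: h_def[symmetric] sh0)
  then have "ip (act (f * h - g * p) x) v = 0" by simp
  then have "(f * h - g * p) * star (ip v x) = 0" using ip_star[of x v] by (simp add: ip_act_left)
  then have "f * h - g * p = 0" by (simp add: fv)
  then show ?thesis by (simp add: f_def h_def g_def p_def)
qed

text \<open>The difference \<open>v\<close> is orthogonal to \<open>x\<close> by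
  \<open>ip_T_mult\<close>, hence to \<open>T x\<close>; being a combination of both, it is
  orthogonal to itself.\<close>

lemma act_ip_T_diagonal: "act (ip (T w) x) x = act (ip w x) (T x)"
proof -
  define v where "v = act (ip (T w) x) x - act (ip w x) (T x)"
  have "ip v x = 0" by (simp add: v_def ip_diff_left ip_act_left ip_T_mult)
  then have xv: "ip x v = 0" using ip_star[of x v] by simp
  then have "ip (T x) v = 0" by (rule orth)
  with xv have "ip v v = 0" by (subst (1) v_def) (simp add: ip_diff_left ip_act_left)
  then show ?thesis by (simp add: ip_eq_0_iff v_def)
qed

lemma act_ip_T: "act (ip (T w) y) u = act (ip w y) (T u)"
proof -
  define F where "F u y = act (ip (T w) y) u - act (ip w y) (T u)" for u y
  have F_add: "F (a + b) c = F a c + F b c" "F c (a + b) = F c a + F c b" for a b c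
    by (simp_all add: F_def T_add ip_add_right act_add_left act_add_right)
  have F_scale: "F (scale k a) c = scale k (F a c)" "F a (scale k c) = scale (cnj k) (F a c)" for k a c
    by (simp_all add: F_def T_scale ip_scale_right act_scaleC_left act_scale_right scale_right_diff_distrib)
  have F0: "F a a = 0" for a by (simp add: F_def act_ip_T_diagonal)
  have swap: "F a b + F b a = 0" for a b
  proof -
    have "F (a + b) (a + b) = F a b + F b a" by (simp only: F_add) (simp add: F0)
    then show ?thesis by (simp only: F0)
  qed
  \<comment> \<open>Replacing \<open>u\<close> by \<open>\<i> u\<close> turns antisymmetry into
    symmetry, as \<open>F\<close> is conjugate linear in its second argument.\<close>
  have "scale \<i> (F u y) + scale (- \<i>) (F y u) = 0"
    using swap[of "scale \<i> u" y] by (simp add: F_scale)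
  then have "scale \<i> (F u y - F y u) = 0" by (simp add: scale_right_diff_distrib)
  then have "F u y = F y u" by simp
  with swap[of u y] have "scale 2 (F u y) = 0"
    using scale_left_distrib[of 1 1 "F u y"] by simp
  then show ?thesis by (simp add: F_def)
qed

text \<open>For \<open>b = ip w y\<close> the value is \<open>ip (T w) y\<close>. Admissible
  \<open>b\<close> form a closed subspace because \<open>norm_le_of_act_bound\<close> makes the
  values Cauchy along with \<open>b\<close>. Describing a value by its action, which determines it
  by \<open>act_faithful\<close>, avoids checking well-definedness on linear combinations of inner
  products.\<close>

lemma ex_multiplier_value: "\<exists>c. \<forall>u. act c u = act b (T u)"
proof -
  obtain K where K: "0 \<le> K" "\<And>x. hnorm (T x) \<le> K * hnorm x" by (rule T_bound) blast
  define D where "D = {b. \<exists>c. \<forall>u. act c u = act b (T u)}"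
  have "cvec.subspace D"
  proof (rule cvec.subspaceI)
    show "0 \<in> D" by (auto simp: D_def intro: exI[of _ 0])
    show "a + b \<in> D" if "a \<in> D" "b \<in> D" for a b
      using that unfolding D_def by clarsimp (metis act_add_left)
    show "c *\<^sub>C a \<in> D" if "a \<in> D" for c a
      using that unfolding D_def by clarsimp (metis act_scaleC_left)
  qed
  moreover have "{ip x y | x y. True} \<subseteq> D" using act_ip_T by (auto simp: D_def)
  ultimately have span: "cvec.span {ip x y | x y. True} \<subseteq> D" by (intro cvec.span_minimal)
  have "closed D"
    unfolding closed_sequential_limits
  proof (intro allI impI, elim conjE)
    fix b l assume "\<forall>n. b n \<in> D" and b: "b \<longlonglongrightarrow> l"
    then obtain c where c: "\<And>n u. act (c n) u = act (b n) (T u)" unfolding D_def by simp metis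
    have le: "norm (c m - c n) \<le> norm (b m - b n) * K" for m n
    proof (rule norm_le_of_act_bound)
      fix u
      have "hnorm (act (c m - c n) u) = hnorm (act (b m - b n) (T u))" by (simp add: act_diff_left c)
      also have "\<dots> \<le> norm (b m - b n) * (K * hnorm u)"
        using hnorm_act_le K(2) by (meson mult_left_mono norm_ge_zero order_trans)
      finally show "hnorm (act (c m - c n) u) \<le> norm (b m - b n) * K * hnorm u" by (simp add: mult.assoc)
    qed (use K in simp)
    have "Cauchy b" using b by (rule LIMSEQ_imp_Cauchy)
    have "Cauchy c"
    proof (rule metric_CauchyI)
      fix e :: real assume e: "0 < e"
      then obtain N where N: "\<And>m n. N \<le> m \<Longrightarrow> N \<le> n \<Longrightarrow> dist (b m) (b n) < e / (K + 1)"
        using metric_CauchyD[OF \<open>Cauchy b\<close>, of "e / (K + 1)"] K(1) by auto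
      have "dist (c m) (c n) < e" if "N \<le> m" "N \<le> n" for m n
      proof -
        have "norm (b m - b n) * (K + 1) < e"
          using N[OF that] K(1) by (simp add: dist_norm field_simps)
        moreover have "norm (b m - b n) * K \<le> norm (b m - b n) * (K + 1)"
          by (intro mult_left_mono) auto
        ultimately show ?thesis using le[of m n] by (simp add: dist_norm)
      qed
      then show "\<exists>M. \<forall>m\<ge>M. \<forall>n\<ge>M. dist (c m) (c n) < e" by blast
    qed
    then obtain k where k: "c \<longlonglongrightarrow> k" using Cauchy_convergent_iff convergent_def by blast
    have "act k u = act l (T u)" for u
    proof -
      have "hnorm (act k u - act l (T u)) \<le> norm (c n - k) * hnorm u + norm (b n - l) * hnorm (T u)" for n
      proof -
        have "act k u - act l (T u) = act (b n - l) (T u) - act (c n - k) u"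
          by (simp add: act_diff_left c)
        then show ?thesis
          using hnorm_triangle_diff[of "act (b n - l) (T u)" "act (c n - k) u"]
            hnorm_act_le[of "b n - l" "T u"] hnorm_act_le[of "c n - k" u] by simp
      qed
      moreover have "(\<lambda>n. norm (c n - k) * hnorm u + norm (b n - l) * hnorm (T u)) \<longlonglongrightarrow>
          0 * hnorm u + 0 * hnorm (T u)"
        using tendsto_norm_zero[OF LIM_zero[OF k]] tendsto_norm_zero[OF LIM_zero[OF b]]
        by (intro tendsto_add tendsto_mult tendsto_const)
      ultimately have "hnorm (act k u - act l (T u)) \<le> 0 * hnorm u + 0 * hnorm (T u)"
        by (intro LIMSEQ_le_const) auto
      then show ?thesis
        using hnorm_eq_0_iff[of "act k u - act l (T u)"] hnorm_nonneg[of "act k u - act l (T u)"] by simp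
    qed
    then show "l \<in> D" by (auto simp: D_def)
  qed
  then have "closure (cvec.span {ip x y | x y. True}) \<subseteq> D" by (rule closure_minimal[OF span])
  then have "b \<in> D" using full by auto
  then show ?thesis by (simp add: D_def)
qed

section \<open>The bimodule map \<open>R\<close>\<close>

definition R :: "'a \<Rightarrow> 'a" where
  "R b = (SOME c. \<forall>u. act c u = act b (T u))"

lemma act_R: "act (R b) u = act b (T u)"
  unfolding R_def using someI_ex[OF ex_multiplier_value[of b]] by blast

lemma R_eqI:
  assumes "\<And>u. act c u = act b (T u)"
  shows "R b = c"
proof -
  have "R b - c = 0" by (rule act_faithful) (simp add: act_diff_left act_R assms)
  then show ?thesis by simp
qed

lemma R_ip: "R (ip x y) = ip (T x) y"
  by (rule R_eqI) (rule act_ip_T)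

text \<open>Linearity on the left comes from the action alone, on the right from
  \<open>T_act\<close>.\<close>

lemma R_add: "R (a + b) = R a + R b"
  and R_mult_left: "R (a * b) = a * R b"
  and R_mult_right: "R (a * b) = R a * b"
  and R_scaleC: "R (c *\<^sub>C a) = c *\<^sub>C R a"
  by (rule R_eqI, simp add: act_add_left act_mult act_scaleC_left act_R T_act)+

lemma R_scaleR: "R (r *\<^sub>R a) = r *\<^sub>R R a"
  using R_scaleC[of "complex_of_real r"] by (simp add: scaleC_of_real)

lemma bounded_linear_R: "bounded_linear R"
proof -
  obtain K where K: "0 \<le> K" "\<And>x. hnorm (T x) \<le> K * hnorm x" by (rule T_bound) blast
  have "norm (R b) \<le> norm b * K" for b
  proof (rule norm_le_of_act_bound)
    fix u
    have "hnorm (act (R b) u) \<le> norm b * hnorm (T u)" by (simp only: act_R hnorm_act_le)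
    also have "\<dots> \<le> norm b * (K * hnorm u)" using K(2) by (rule mult_left_mono) simp
    finally show "hnorm (act (R b) u) \<le> norm b * K * hnorm u" by (simp add: mult.assoc)
  qed (use K in simp)
  then show ?thesis by (rule bounded_linear_intro[OF R_add R_scaleR])
qed

lemma double_centralizer_R: "double_centralizer R R"
  unfolding double_centralizer_def bounded_clinear_def
  by (auto simp: bounded_linear_R R_scaleC R_mult_right R_mult_left[symmetric])

lemma mact_R: "mact (Abs_multiplier (R, R)) = T"
  using morphism
  by (intro mact_eqI) (simp_all add: bounded_morphism_def mul_Abs[OF double_centralizer_R] act_R)

section \<open>Invertibility when \<open>T\<close> is onto\<close>

context
  assumes surj: "surj T"
begin

lemma R_bounded_below: "\<exists>C. \<forall>b. norm b \<le> C * norm (R b)"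
proof -
  have "\<exists>C. \<forall>b\<in>{b. norm (R b) \<le> 1}. norm b \<le> C"
  proof (rule uniform_boundedness)
    fix x
    obtain z where z: "x = T z" using surj by blast
    have "hnorm (act b x) \<le> hnorm z" if "norm (R b) \<le> 1" for b
    proof -
      have "hnorm (act b x) = hnorm (act (R b) z)" by (simp only: z act_R)
      also have "\<dots> \<le> norm (R b) * hnorm z" by (rule hnorm_act_le)
      also have "\<dots> \<le> 1 * hnorm z" using that by (rule mult_right_mono) simp
      finally show ?thesis by simp
    qed
    then show "\<exists>C. \<forall>b\<in>{b. norm (R b) \<le> 1}. hnorm (act b x) \<le> C" by blast
  qed
  then obtain C where C: "\<And>b. norm (R b) \<le> 1 \<Longrightarrow> norm b \<le> C" by blast
  have "norm b \<le> C * norm (R b)" for b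
  proof (cases "R b = 0")
    case False
    have "norm ((1 / norm (R b)) *\<^sub>R b) \<le> C" using False by (intro C) (simp add: R_scaleR)
    then show ?thesis using False by (simp add: divide_le_eq)
  next
    case True
    \<comment> \<open>If \<open>R b = 0\<close>, all multiples of \<open>b\<close> lie in the set
      bounded by \<open>C\<close>.\<close>
    have "real n * norm b \<le> C" for n using C[of "real n *\<^sub>R b"] True by (simp add: R_scaleR)
    then have "\<not> 0 < norm b" using ex_less_of_nat_mult[of "norm b" C] by (meson not_le)
    with True show ?thesis by simp
  qed
  then show ?thesis by blast
qed

lemma inj_R: "inj R"
proof (rule injI)
  fix a b assume "R a = R b"
  obtain C where C: "\<And>b. norm b \<le> C * norm (R b)" using R_bounded_below by blast
  have "R (a - b) = 0"
    using \<open>R a = R b\<close> by (simp add: linear_diff[OF bounded_linear.linear[OF bounded_linear_R]])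
  then show "a = b" using C[of "a - b"] by simp
qed

text \<open>Being bounded below, \<open>R\<close> has complete and hence closed range, which
  contains every \<open>ip (T z) y = R (ip z y)\<close>. The constant
  \<open>\<bar>C\<bar> + 1\<close> is positive and may be inverted.\<close>

lemma surj_R: "surj R"
proof -
  obtain C where C: "\<And>b. norm b \<le> C * norm (R b)" using R_bounded_below by blast
  have "(1 / (\<bar>C\<bar> + 1)) * norm b \<le> norm (R b)" for b
  proof -
    have "C * norm (R b) \<le> (\<bar>C\<bar> + 1) * norm (R b)" by (intro mult_right_mono) auto
    with C[of b] have "norm b \<le> (\<bar>C\<bar> + 1) * norm (R b)" by linarith
    then show ?thesis by (simp add: divide_le_eq mult.commute)
  qed
  then have "complete (R ` UNIV)"
    by (intro complete_isometric_image[of "1 / (\<bar>C\<bar> + 1)"]) (auto simp: bounded_linear_R complete_UNIV)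
  then have closed: "closed (range R)" by (rule complete_imp_closed)
  have "cvec.subspace (range R)"
  proof (rule cvec.subspaceI)
    have "R 0 = 0" using R_scaleR[of 0 0] by simp
    then show "0 \<in> range R" by (metis rangeI)
    show "a + b \<in> range R" if "a \<in> range R" "b \<in> range R" for a b
      using that by (auto simp: R_add[symmetric])
    show "c *\<^sub>C a \<in> range R" if "a \<in> range R" for c a
      using that by (auto simp: R_scaleC[symmetric])
  qed
  moreover have "{ip x y | x y. True} \<subseteq> range R"
  proof clarify
    fix x y
    obtain z where "x = T z" using surj by blast
    then show "ip x y \<in> range R" by (metis R_ip rangeI)
  qed
  ultimately have "cvec.span {ip x y | x y. True} \<subseteq> range R" by (intro cvec.span_minimal)
  from closure_minimal[OF this closed] show ?thesis using full by auto
qed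

lemma double_centralizer_inv_R: "double_centralizer (inv R) (inv R)"
proof -
  have RS: "R (inv R a) = a" for a using surj_R by (rule surj_f_inv_f)
  have eqI: "inv R a = b" if "R b = a" for a b using that inj_R by (metis inv_f_f)
  obtain C where C: "\<And>b. norm b \<le> C * norm (R b)" using R_bounded_below by blast
  have add: "inv R (a + b) = inv R a + inv R b" for a b by (rule eqI) (simp add: R_add RS)
  have scaleR: "inv R (r *\<^sub>R a) = r *\<^sub>R inv R a" for r a by (rule eqI) (simp add: R_scaleR RS)
  have scaleC: "inv R (c *\<^sub>C a) = c *\<^sub>C inv R a" for c a by (rule eqI) (simp add: R_scaleC RS)
  have mult: "inv R (a * b) = inv R a * b" for a b by (rule eqI) (simp add: R_mult_right RS)
  have mult': "inv R (a * b) = a * inv R b" for a b by (rule eqI) (simp add: R_mult_left RS)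
  have "norm (inv R a) \<le> norm a * C" for a using C[of "inv R a"] by (simp add: RS mult.commute)
  then have "bounded_linear (inv R)" by (rule bounded_linear_intro[OF add scaleR])
  then show ?thesis
    unfolding double_centralizer_def bounded_clinear_def
    using mult mult' by (metis scaleC)
qed

theorem ex_invertible_central_multiplier:
  "\<exists>d\<in>center. (\<exists>e\<in>center. d * e = 1 \<and> e * d = 1) \<and> mact d = T"
proof -
  define d where "d = Abs_multiplier (R, R)"
  define e where "e = Abs_multiplier (inv R, inv R)"
  have d: "lmul d = R" "rmul d = R" by (simp_all add: d_def mul_Abs[OF double_centralizer_R])
  have e: "lmul e = inv R" "rmul e = inv R" by (simp_all add: e_def mul_Abs[OF double_centralizer_inv_R])
  have "d \<in> center" "e \<in> center" by (simp_all add: center_multiplierI d e)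
  moreover have "d * e = 1" "e * d = 1"
    by (rule mul_ext, simp add: mul_times mul_one d e surj_R surj_f_inv_f inj_R)+
  moreover have "mact d = T" unfolding d_def by (rule mact_R)
  ultimately show ?thesis by blast
qed

end

end

theorem corollary1p3:
  fixes scale :: "complex \<Rightarrow> 'x::ab_group_add \<Rightarrow> 'x"
    and act :: "'a::cstar_algebra \<Rightarrow> 'x \<Rightarrow> 'x"
    and ip :: "'x \<Rightarrow> 'x \<Rightarrow> 'a"
    and T :: "'x \<Rightarrow> 'x"
  assumes "full_hilbert_module scale act ip"
    and "hilbert_module.bounded_morphism scale act ip T"
    and "bij T"
    and "\<And>Y. hilbert_module.submodule scale act Y \<Longrightarrow> T ` Y \<subseteq> Y"
  shows "\<exists>d \<in> (center :: 'a multiplier set).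
           (\<exists>e \<in> center. d * e = 1 \<and> e * d = 1) \<and>
           (\<forall>x. T x = hilbert_module.mact scale act ip d x)"
proof -
  interpret full_hilbert_module scale act ip by (rule assms(1))
  have "orthogonality_preserving_morphism scale act ip T"
  proof unfold_locales
    show "bounded_morphism T" by (rule assms(2))
  next
    fix x z assume "ip x z = 0"
    have "submodule {y. ip y z = 0}"
      by (auto simp: submodule_def subspace_def ip_add_left ip_scale_left ip_act_left)
    from assms(4)[OF this] show "ip (T x) z = 0" using \<open>ip x z = 0\<close> by blast
  qed
  then interpret orthogonality_preserving_morphism scale act ip T .
  have "surj T" using assms(3) by (rule bij_is_surj)
  from ex_invertible_central_multiplier[OF this] show ?thesis by metis
qed

end
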